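(* There exists an absolute constant $C>0$ such that the following holds. Let $m\ge 1$ be an integer, and let $$p(t)=\sum_{j=1}^m c_j e^{\lambda_j t},\qquad c_j,\lambda_j\in\mathbb C,$$ be a nonzero exponential polynomial of order at most $m$. Put $$M_{\Re}=\max_{\lambda\in\operatorname{spec}p}|\operatorname{Re}\lambda|.$$ Let $I\subset\mathbb R$ be a bounded interval, and let $E\subset I$ be measurable with $|E|>0$. Then $$\sup_I|p|\le \exp(|I|M_{\Re})\left(\frac{C|I|}{|E|}\right)^{m-1}G_E(p).$$
   Context: A reduced exponential polynomial is a finite sum $p(t)=\sum_{\lambda\in\Lambda}c_\lambda e^{\lambda t}$ with all $c_\lambda\neq0$ and the exponents $\lambda\in\Lambda\subset\mathbb C$ distinct; any exponential polynomial is brought to this form by combining equal exponents and deleting zero coefficients. Then $\operatorname{spec}p=\Lambda$ and $\operatorname{ord}p=|\Lambda|$ (the order). $|\cdot|$ applied to a subset of $\mathbb R$ denotes Lebesgue measure. For a measurable set $E\subset\mathbb R$ with $|E|>0$ and a nonzero exponential polynomial $g$, the geometric mean is $$G_E(g)=\exp\left(\frac1{|E|}\int_E\log|g(t)|\,dt\right);$$ $g$ has finitely many zeros on compact real intervals, and $\log|g|$ is integrable there after being redefined on this finite set. "Absolute constant" means independent of all other data in the statement. *)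

theory Defs
  imports "HOL-Analysis.Analysis" "HOL-Computational_Algebra.Polynomial"
begin

definition reduced_form :: "(real \<Rightarrow> complex) \<Rightarrow> complex set \<Rightarrow> (complex \<Rightarrow> complex) \<Rightarrow> bool" where
  "reduced_form p S c \<longleftrightarrow> finite S \<and> (\<forall>\<alpha>\<in>S. c \<alpha> \<noteq> 0) \<and>
     (\<forall>t. p t = (\<Sum>\<alpha>\<in>S. c \<alpha> * exp (\<alpha> * of_real t)))"

text \<open>The description below is meaningful for exponential polynomials only: the lemmas
  \<open>exp_spec_eq\<close> and \<open>ex_reduced_form\<close> show that the reduced form exists and that its
  exponent set is determined by the function.\<close>

definition exp_spec :: "(real \<Rightarrow> complex) \<Rightarrow> complex set" where
  "exp_spec p = (THE S. \<exists>c. reduced_form p S c)"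

definition exp_ord :: "(real \<Rightarrow> complex) \<Rightarrow> nat" where
  "exp_ord p = card (exp_spec p)"

text \<open>The value \<^term>\<open>ln (0::real)\<close> is a junk value; it enters only at the zeros of \<open>g\<close>,
  a null set for a nonzero exponential polynomial.\<close>

definition geo_mean :: "real set \<Rightarrow> (real \<Rightarrow> complex) \<Rightarrow> real" where
  "geo_mean E g = exp ((1 / measure lebesgue E) * (LINT t:E|lebesgue. ln (norm (g t))))"

lemma exp_sum_zero_coeff:
  fixes c :: "complex \<Rightarrow> complex"
  assumes S: "finite S" and z: "\<And>t::real. (\<Sum>\<alpha>\<in>S. c \<alpha> * exp (\<alpha> * of_real t)) = 0"
    and mu: "\<mu> \<in> S"
  shows "c \<mu> = 0"
proof -
  have der: "(\<Sum>\<alpha>\<in>S. c \<alpha> * \<alpha> ^ k * exp (\<alpha> * of_real t)) = 0" for k and t :: real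
  proof (induction k arbitrary: t)
    case 0
    then show ?case using z by simp
  next
    case (Suc k)
    let ?f = "\<lambda>t::real. \<Sum>\<alpha>\<in>S. c \<alpha> * \<alpha> ^ k * exp (\<alpha> * of_real t)"
    have 1: "(?f has_vector_derivative (\<Sum>\<alpha>\<in>S. c \<alpha> * \<alpha> ^ Suc k * exp (\<alpha> * of_real t))) (at t)"
    proof (rule has_vector_derivative_sum)
      fix \<alpha>
      have "((\<lambda>z. c \<alpha> * \<alpha> ^ k * exp (\<alpha> * z)) has_field_derivative
              (c \<alpha> * \<alpha> ^ Suc k * exp (\<alpha> * of_real t))) (at (of_real t))"
        by (auto intro!: derivative_eq_intros)
      then show "((\<lambda>t. c \<alpha> * \<alpha> ^ k * exp (\<alpha> * of_real t)) has_vector_derivative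
              (c \<alpha> * \<alpha> ^ Suc k * exp (\<alpha> * of_real t))) (at t)"
        by (rule has_vector_derivative_real_field)
    qed
    have "?f = (\<lambda>_. 0)" using Suc by auto
    then have 2: "(?f has_vector_derivative 0) (at t)" by simp
    show ?case using vector_derivative_unique_at[OF 1 2] .
  qed
  have pol: "(\<Sum>\<alpha>\<in>S. c \<alpha> * poly q \<alpha>) = 0" for q
  proof -
    have "(\<Sum>\<alpha>\<in>S. c \<alpha> * poly q \<alpha>) = (\<Sum>i\<le>degree q. coeff q i * (\<Sum>\<alpha>\<in>S. c \<alpha> * \<alpha> ^ i))"
      unfolding poly_altdef sum_distrib_left by (subst sum.swap) (simp add: mult_ac)
    also have "\<dots> = 0" using der[of _ 0] by simp
    finally show ?thesis .
  qed
  define q where "q = (\<Prod>\<nu>\<in>S - {\<mu>}. [:- \<nu>, 1:])"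
  have "poly q \<alpha> = 0" if "\<alpha> \<in> S - {\<mu>}" for \<alpha>
    unfolding q_def poly_prod using that S by (intro prod_zero) auto
  then have "(\<Sum>\<alpha>\<in>S. c \<alpha> * poly q \<alpha>) = c \<mu> * poly q \<mu>"
    using S mu by (subst sum.remove[of _ \<mu>]) auto
  moreover have "poly q \<mu> \<noteq> 0"
    unfolding q_def poly_prod using S by auto
  ultimately show ?thesis using pol[of q] by simp
qed

lemma reduced_form_unique:
  assumes a: "reduced_form p S c" and b: "reduced_form p T d"
  shows "S = T"
proof -
  define e where "e = (\<lambda>\<alpha>. (if \<alpha> \<in> S then c \<alpha> else 0) - (if \<alpha> \<in> T then d \<alpha> else 0))"
  have fin: "finite S" "finite T" using a b by (auto simp: reduced_form_def)
  have "(\<Sum>\<alpha>\<in>S \<union> T. e \<alpha> * exp (\<alpha> * of_real t)) = 0" for t :: real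
  proof -
    have "(\<Sum>\<alpha>\<in>S \<union> T. e \<alpha> * exp (\<alpha> * of_real t)) =
       (\<Sum>\<alpha>\<in>S \<union> T. (if \<alpha> \<in> S then c \<alpha> else 0) * exp (\<alpha> * of_real t)) -
       (\<Sum>\<alpha>\<in>S \<union> T. (if \<alpha> \<in> T then d \<alpha> else 0) * exp (\<alpha> * of_real t))"
      unfolding e_def by (simp add: left_diff_distrib sum_subtractf)
    also have "(\<Sum>\<alpha>\<in>S \<union> T. (if \<alpha> \<in> S then c \<alpha> else 0) * exp (\<alpha> * of_real t)) = p t"
      using a fin unfolding reduced_form_def
      by (auto intro!: sum.mono_neutral_cong_right)
    also have "(\<Sum>\<alpha>\<in>S \<union> T. (if \<alpha> \<in> T then d \<alpha> else 0) * exp (\<alpha> * of_real t)) = p t"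
      using b fin unfolding reduced_form_def
      by (auto intro!: sum.mono_neutral_cong_right)
    finally show ?thesis by simp
  qed
  then have e0: "e \<alpha> = 0" if "\<alpha> \<in> S \<union> T" for \<alpha>
    using exp_sum_zero_coeff[of "S \<union> T" e \<alpha>] fin that by auto
  show ?thesis
  proof (rule set_eqI)
    fix \<alpha>
    show "\<alpha> \<in> S \<longleftrightarrow> \<alpha> \<in> T"
      using e0[of \<alpha>] a b by (auto simp: e_def reduced_form_def split: if_splits)
  qed
qed

lemma exp_spec_eq: "reduced_form p S c \<Longrightarrow> exp_spec p = S"
  unfolding exp_spec_def by (rule the_equality) (auto dest: reduced_form_unique)

lemma ex_reduced_form:
  fixes c \<alpha> :: "nat \<Rightarrow> complex"
  assumes p: "\<And>t. p t = (\<Sum>j=1..m. c j * exp (\<alpha> j * of_real t))"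
  defines "d \<equiv> \<lambda>\<mu>. \<Sum>j | j \<in> {1..m} \<and> \<alpha> j = \<mu>. c j"
  shows "reduced_form p {\<mu> \<in> \<alpha> ` {1..m}. d \<mu> \<noteq> 0} d"
  unfolding reduced_form_def
proof (intro conjI allI)
  fix t :: real
  have "p t = (\<Sum>\<mu>\<in>\<alpha> ` {1..m}. \<Sum>j | j \<in> {1..m} \<and> \<alpha> j = \<mu>. c j * exp (\<alpha> j * of_real t))"
    unfolding p by (rule sum.image_gen) simp
  also have "\<dots> = (\<Sum>\<mu>\<in>\<alpha> ` {1..m}. d \<mu> * exp (\<mu> * of_real t))"
    unfolding d_def sum_distrib_right by (intro sum.cong) auto
  also have "\<dots> = (\<Sum>\<mu>\<in>{\<mu> \<in> \<alpha> ` {1..m}. d \<mu> \<noteq> 0}. d \<mu> * exp (\<mu> * of_real t))"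
    by (rule sum.mono_neutral_right) auto
  finally show "p t = (\<Sum>\<mu>\<in>{\<mu> \<in> \<alpha> ` {1..m}. d \<mu> \<noteq> 0}. d \<mu> * exp (\<mu> * of_real t))" .
qed auto

end

theory Submission
  imports Defs "HOL-Complex_Analysis.Complex_Analysis"
begin

text \<open>Let \<open>p\<close> have the exponent set \<open>S\<close> of size \<open>n\<close> and diameter \<open>d = \<bar>\<alpha> - \<beta>\<bar>\<close>, and let \<open>I\<close> have length \<open>l\<close>;
  induct on \<open>n\<close>. The identity \<open>(\<alpha> - \<beta>) p = (p' - \<beta> p) - (p' - \<alpha> p)\<close> bounds \<open>p\<close> by two exponential sums of
  order \<open>n - 1\<close>. With \<open>z\<^sub>k\<close> the zeros of \<open>p\<close> near \<open>I\<close>, the quotient \<open>(p' - \<alpha> p) / p\<close> is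
  \<open>\<Sum>k. 1 / (t - z\<^sub>k)\<close> up to an error \<open>O(n / l + d)\<close>, and there are \<open>O(n + d l)\<close> zeros. For \<open>N\<close> poles
  in the closed lower half-plane, the integral of \<open>ln \<bar>1 + \<i> a \<Sum>k. 1 / (t - z\<^sub>k)\<bar>\<close> over the real line is
  \<open>O(a N)\<close>; poles in the upper half-plane are reflected.
  If \<open>d l \<ge> n - 1\<close>, the geometric mean of \<open>(p' - \<alpha> p) / d\<close> on \<open>E\<close> is therefore at
  most \<open>C l / \<bar>E\<bar>\<close> times that of \<open>p\<close>, and the induction closes.
  If \<open>d l \<le> n - 1\<close>, then \<open>p\<close> behaves like a polynomial of degree \<open>n - 1\<close>: the maximum of \<open>\<bar>p\<bar>\<close> over a disc
  grows by at most \<open>n (\<rho> / \<sigma>) ^ (n - 1) exp (2 d \<rho>)\<close> from radius \<open>\<sigma>\<close> to \<open>\<rho>\<close>. Applied to the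
  discs of radius \<open>\<bar>E\<bar>\<close> about the points of \<open>E\<close>, this bounds \<open>\<bar>p\<bar>\<close> from below on \<open>E\<close>, up to the
  factors \<open>min 1 (\<bar>t - z\<^sub>k\<bar> / \<bar>E\<bar>)\<close>, whose logarithms have integral \<open>O(\<bar>E\<bar>)\<close> each.\<close>

section \<open>Growth of exponential sums\<close>

definition expsum :: "complex set \<Rightarrow> (complex \<Rightarrow> complex) \<Rightarrow> complex \<Rightarrow> complex" where
  "expsum S c z = (\<Sum>\<alpha>\<in>S. c \<alpha> * exp (\<alpha> * z))"

lemma expsum_deriv:
  "(expsum S c has_field_derivative expsum S (\<lambda>\<alpha>. \<alpha> * c \<alpha>) z) (at z)"
  unfolding expsum_def by (auto intro!: derivative_eq_intros sum.cong simp: mult_ac)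

lemma expsum_holomorphic [holomorphic_intros]: "expsum S c holomorphic_on A"
  using expsum_deriv holomorphic_on_def has_field_derivative_at_within
  by (metis field_differentiable_def)

lemma continuous_on_expsum: "continuous_on A (expsum S c)"
  by (intro holomorphic_on_imp_continuous_on holomorphic_intros)

lemma expsum_higher_deriv:
  "(deriv ^^ i) (expsum S c) = expsum S (\<lambda>\<alpha>. \<alpha> ^ i * c \<alpha>)"
proof (induction i)
  case (Suc i)
  have "(deriv ^^ Suc i) (expsum S c) = deriv (expsum S (\<lambda>\<alpha>. \<alpha> ^ i * c \<alpha>))"
    using Suc by simp
  also have "\<dots> = expsum S (\<lambda>\<alpha>. \<alpha> * (\<alpha> ^ i * c \<alpha>))"
    using DERIV_imp_deriv[OF expsum_deriv] by blast
  finally show ?case by (simp add: mult_ac)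
qed (simp add: fun_eq_iff)

lemma expsum_shift: "expsum S c (t + z) = expsum S (\<lambda>\<alpha>. c \<alpha> * exp (\<alpha> * t)) z"
  by (simp add: expsum_def distrib_left exp_add mult_ac)

text \<open>Passing from \<open>p\<close> to \<open>p' - \<mu> p\<close> removes the exponent \<open>\<mu>\<close>; the bound is integrated
  along the ray through \<open>z\<close>.\<close>

lemma expsum_bound_Taylor:
  assumes "finite S" "S \<subseteq> cball 0 d"
  shows "norm (expsum S c z) \<le>
    exp (2 * d * norm z) * (\<Sum>i<card S. norm z ^ i / fact i * norm (\<Sum>\<alpha>\<in>S. c \<alpha> * \<alpha> ^ i))"
  using assms
proof (induction S arbitrary: c z rule: finite_induct)
  case empty
  then show ?case by (simp add: expsum_def)
next
  case (insert \<mu> S)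
  define n where "n = card S"
  define B where "B i = norm (\<Sum>\<alpha>\<in>insert \<mu> S. c \<alpha> * \<alpha> ^ i)" for i
  define q where "q = expsum S (\<lambda>\<alpha>. (\<alpha> - \<mu>) * c \<alpha>)"
  let ?p = "expsum (insert \<mu> S) c"
  have mu: "norm \<mu> \<le> d" and d: "d \<ge> 0" and Sd: "S \<subseteq> cball 0 d"
    using insert.prems order_trans[OF norm_ge_zero] by auto
  have card: "card (insert \<mu> S) = Suc n" using insert.hyps by (simp add: n_def)
  have q_eq: "expsum (insert \<mu> S) (\<lambda>\<alpha>. \<alpha> * c \<alpha>) w - \<mu> * ?p w = q w" for w
    using insert.hyps
    by (simp add: q_def expsum_def sum_subtractf sum_distrib_left algebra_simps)
  have Bq: "norm (\<Sum>\<alpha>\<in>S. (\<alpha> - \<mu>) * c \<alpha> * \<alpha> ^ i) \<le> B (Suc i) + d * B i" for i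
  proof -
    have "(\<Sum>\<alpha>\<in>S. (\<alpha> - \<mu>) * c \<alpha> * \<alpha> ^ i) =
        (\<Sum>\<alpha>\<in>insert \<mu> S. c \<alpha> * \<alpha> ^ Suc i) - \<mu> * (\<Sum>\<alpha>\<in>insert \<mu> S. c \<alpha> * \<alpha> ^ i)"
      using insert.hyps by (simp add: sum_subtractf sum_distrib_left algebra_simps)
    also have "norm \<dots> \<le> B (Suc i) + norm \<mu> * B i"
      unfolding B_def norm_mult[symmetric] by (rule norm_triangle_ineq4)
    also have "\<dots> \<le> B (Suc i) + d * B i"
      using mu by (simp add: mult_right_mono B_def)
    finally show ?thesis .
  qed
  show ?case
  proof (cases "z = 0")
    case True
    have "norm (?p 0) = B 0" by (simp add: expsum_def B_def)
    moreover have "(\<Sum>i<Suc n. 0 ^ i / fact i * B i) = B 0"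
      by (subst sum.lessThan_Suc_shift) simp
    ultimately show ?thesis using True by (simp only: card B_def[symmetric]) simp
  next
    case False
    define \<rho> where "\<rho> = norm z"
    define u where "u = z / of_real \<rho>"
    have \<rho>: "\<rho> > 0" and u: "norm u = 1" and z: "z = u * of_real \<rho>"
      using False by (auto simp: \<rho>_def u_def norm_divide)
    \<comment> \<open>The leading factor is chosen so that the term with \<mu> cancels: the
      derivative of \<open>f\<close> involves only \<open>q\<close>, to which the induction
      hypothesis applies, while \<open>f \<rho>\<close> is \<open>?p z\<close>.\<close>
    define f where "f \<tau> = exp (\<mu> * u * of_real (\<rho> - \<tau>)) * ?p (u * of_real \<tau>)" for \<tau>
    define f' where "f' \<tau> = exp (\<mu> * u * of_real (\<rho> - \<tau>)) * u * q (u * of_real \<tau>)" for \<tau>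
    \<comment> \<open>A majorant: \<open>\<phi> 0\<close> dominates \<open>norm (f 0)\<close>, the
      derivative of \<open>\<phi>\<close> dominates \<open>norm (f' \<tau>)\<close>, and
      \<open>\<phi> \<rho>\<close> is the claimed bound.\<close>
    define \<phi> where "\<phi> \<tau> = exp (d * \<rho>) * (exp (d * \<tau>) * (\<Sum>i<Suc n. \<tau> ^ i / fact i * B i))" for \<tau> :: real
    define \<phi>' where "\<phi>' \<tau> = exp (d * \<rho>) * (exp (d * \<tau>) * d * (\<Sum>i<Suc n. \<tau> ^ i / fact i * B i)
        + (\<Sum>i<n. \<tau> ^ i / fact i * B (Suc i)) * exp (d * \<tau>))" for \<tau> :: real
    have f_deriv: "(f has_vector_derivative f' \<tau>) (at \<tau>)" for \<tau>
    proof -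
      have "((\<lambda>w. exp (\<mu> * u * (of_real \<rho> - w)) * ?p (u * w)) has_field_derivative f' \<tau>) (at (of_real \<tau>))"
        by (rule derivative_eq_intros DERIV_chain2[OF expsum_deriv] refl)+
          (simp add: f'_def q_eq[symmetric] algebra_simps)
      from has_vector_derivative_real_field[OF this] show ?thesis
        unfolding f_def by simp
    qed
    have \<phi>_deriv: "(\<phi> has_vector_derivative \<phi>' \<tau>) (at \<tau>)" for \<tau>
    proof -
      have "((\<lambda>\<tau>::real. \<Sum>i<n. \<tau> ^ Suc i / fact (Suc i) * B (Suc i)) has_field_derivative
         (\<Sum>i<n. \<tau> ^ i / fact i * B (Suc i))) (at \<tau>)"
      proof (rule DERIV_sum)
        fix i
        have "((\<lambda>\<tau>::real. \<tau> ^ Suc i) has_field_derivative real (Suc i) * \<tau> ^ i) (at \<tau>)"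
          using DERIV_pow[of "Suc i" \<tau>] by simp
        from DERIV_cmult_right[OF DERIV_cdivide[OF this, of "fact (Suc i)"], of "B (Suc i)"]
        have "((\<lambda>\<tau>::real. \<tau> ^ Suc i / fact (Suc i) * B (Suc i)) has_field_derivative
          real (Suc i) * \<tau> ^ i / fact (Suc i) * B (Suc i)) (at \<tau>)" .
        then show "((\<lambda>\<tau>::real. \<tau> ^ Suc i / fact (Suc i) * B (Suc i)) has_field_derivative
          \<tau> ^ i / fact i * B (Suc i)) (at \<tau>)"
          by (simp del: of_nat_Suc power_Suc)
      qed
      then have G: "((\<lambda>\<tau>::real. \<Sum>i<Suc n. \<tau> ^ i / fact i * B i) has_field_derivative
         (\<Sum>i<n. \<tau> ^ i / fact i * B (Suc i))) (at \<tau>)"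
        unfolding sum.lessThan_Suc_shift using DERIV_add[OF DERIV_const] by fastforce
      have E: "((\<lambda>\<tau>. exp (d * \<tau>)) has_field_derivative exp (d * \<tau>) * d) (at \<tau>)"
        by (auto intro!: derivative_eq_intros)
      have "(\<phi> has_field_derivative \<phi>' \<tau>) (at \<tau>)"
        unfolding \<phi>_def \<phi>'_def by (rule DERIV_cmult[OF DERIV_mult[OF E G]])
      then show ?thesis by (simp add: has_real_derivative_iff_has_vector_derivative)
    qed
    have bound: "norm (f' \<tau>) \<le> \<phi>' \<tau>" if \<tau>: "0 < \<tau>" "\<tau> < \<rho>" for \<tau>
    proof -
      have "norm (exp (\<mu> * u * of_real (\<rho> - \<tau>))) \<le> exp (norm (\<mu> * u * of_real (\<rho> - \<tau>)))"
        by (rule norm_exp)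
      also have "\<dots> \<le> exp (d * (\<rho> - \<tau>))"
        using u mu \<tau> by (simp add: norm_mult del: of_real_diff)
      finally have e: "norm (exp (\<mu> * u * of_real (\<rho> - \<tau>))) \<le> exp (d * (\<rho> - \<tau>))" .
      have "norm (q (u * of_real \<tau>)) \<le> exp (2 * d * \<tau>) *
          (\<Sum>i<n. \<tau> ^ i / fact i * norm (\<Sum>\<alpha>\<in>S. (\<alpha> - \<mu>) * c \<alpha> * \<alpha> ^ i))"
        using insert.IH[OF Sd, of "\<lambda>\<alpha>. (\<alpha> - \<mu>) * c \<alpha>" "u * of_real \<tau>"] \<tau> u
        by (simp add: q_def n_def norm_mult)
      also have "\<dots> \<le> exp (2 * d * \<tau>) * (\<Sum>i<n. \<tau> ^ i / fact i * (B (Suc i) + d * B i))"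
        using \<tau> by (intro mult_left_mono sum_mono Bq) auto
      finally have "norm (f' \<tau>) \<le> exp (d * (\<rho> - \<tau>)) *
          (exp (2 * d * \<tau>) * (\<Sum>i<n. \<tau> ^ i / fact i * (B (Suc i) + d * B i)))"
        unfolding f'_def norm_mult u mult_1_right by (intro mult_mono e) auto
      also have "\<dots> = exp (d * \<rho>) * (exp (d * \<tau>) * (\<Sum>i<n. \<tau> ^ i / fact i * (B (Suc i) + d * B i)))"
      proof -
        have "exp (d * (\<rho> - \<tau>)) * exp (2 * d * \<tau>) = exp (d * \<rho>) * exp (d * \<tau>)"
          by (simp add: exp_add[symmetric] algebra_simps)
        then show ?thesis by (simp only: mult.assoc[symmetric])
      qed
      also have "\<dots> \<le> exp (d * \<rho>) * (exp (d * \<tau>) *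
          (d * (\<Sum>i<Suc n. \<tau> ^ i / fact i * B i) + (\<Sum>i<n. \<tau> ^ i / fact i * B (Suc i))))"
      proof (intro mult_left_mono)
        have "(\<Sum>i<n. \<tau> ^ i / fact i * (B (Suc i) + d * B i)) =
          d * (\<Sum>i<n. \<tau> ^ i / fact i * B i) + (\<Sum>i<n. \<tau> ^ i / fact i * B (Suc i))"
          by (simp add: sum_distrib_left sum.distrib algebra_simps)
        \<comment> \<open>The induction hypothesis stops at \<open>i < n\<close>; the term
          \<open>i = n\<close> of the majorant is nonnegative and may be added.\<close>
        moreover have "0 \<le> d * (\<tau> ^ n / fact n * B n)" using d \<tau> by (simp add: B_def)
        ultimately show "(\<Sum>i<n. \<tau> ^ i / fact i * (B (Suc i) + d * B i)) \<le>
           d * (\<Sum>i<Suc n. \<tau> ^ i / fact i * B i) + (\<Sum>i<n. \<tau> ^ i / fact i * B (Suc i))"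
          by (simp add: distrib_left)
      qed auto
      also have "\<dots> = \<phi>' \<tau>" by (simp add: \<phi>'_def algebra_simps)
      finally show ?thesis .
    qed
    have "norm (f \<rho> - f 0) \<le> \<phi> \<rho> - \<phi> 0"
    proof (rule differentiable_bound_general)
      show "continuous_on {0..\<rho>} f" "continuous_on {0..\<rho>} \<phi>"
        using f_deriv \<phi>_deriv
        by (meson continuous_at_imp_continuous_on has_vector_derivative_continuous)+
    qed (use \<rho> f_deriv \<phi>_deriv bound in auto)
    moreover have "f \<rho> = ?p z" by (simp add: f_def z)
    moreover have "norm (f 0) \<le> \<phi> 0"
    proof -
      have "norm (exp (\<mu> * u * of_real \<rho>)) \<le> exp (norm (\<mu> * u * of_real \<rho>))"
        by (rule norm_exp)
      also have "\<dots> \<le> exp (d * \<rho>)" using u mu \<rho> by (simp add: norm_mult)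
      finally have "norm (f 0) \<le> exp (d * \<rho>) * norm (?p 0)"
        by (simp add: f_def norm_mult mult_right_mono)
      also have "norm (?p 0) = B 0" by (simp add: expsum_def B_def)
      also have "exp (d * \<rho>) * B 0 = \<phi> 0"
        unfolding \<phi>_def by (subst sum.lessThan_Suc_shift) simp
      finally show ?thesis .
    qed
    moreover have "norm (f \<rho>) \<le> norm (f \<rho> - f 0) + norm (f 0)"
      by (metis diff_add_cancel norm_triangle_ineq)
    ultimately have "norm (?p z) \<le> \<phi> \<rho>" by simp
    also have "\<phi> \<rho> = exp (2 * d * \<rho>) * (\<Sum>i<Suc n. \<rho> ^ i / fact i * B i)"
    proof -
      have "exp (d * \<rho>) * exp (d * \<rho>) = exp (2 * d * \<rho>)"
        by (simp add: exp_add[symmetric])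
      then show ?thesis unfolding \<phi>_def by (simp only: mult.assoc[symmetric])
    qed
    finally show ?thesis by (simp only: card B_def \<rho>_def)
  qed
qed

text \<open>The Taylor bound needs only the derivatives at \<open>t\<close> of order below
  \<open>card S\<close>, and Cauchy's inequality on the disc of radius \<sigma> controls these. So
  the ratio \<rho> / \<sigma> enters as it would for a polynomial of degree
  \<open>card S - 1\<close>.\<close>

lemma expsum_growth:
  assumes S: "finite S" "S \<subseteq> cball 0 d" "S \<noteq> {}"
    and \<sigma>: "0 < \<sigma>" "\<sigma> \<le> \<rho>" and w: "w \<in> cball t \<rho>"
    and M: "\<And>z. z \<in> cball t \<sigma> \<Longrightarrow> norm (expsum S c z) \<le> M"
  shows "norm (expsum S c w) \<le> real (card S) * (\<rho> / \<sigma>) ^ (card S - 1) * exp (2 * d * \<rho>) * M"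
proof -
  define e where "e = (\<lambda>\<alpha>. c \<alpha> * exp (\<alpha> * t))"
  have d: "d \<ge> 0" using S order_trans[OF norm_ge_zero] by fastforce
  have M0: "M \<ge> 0" using M[of t] \<sigma> order_trans[OF norm_ge_zero] by auto
  \<comment> \<open>For the coefficients \<open>e\<close>, recentred at \<open>t\<close>, these
    moments are the derivatives of the sum at \<open>t\<close>.\<close>
  have b: "norm (\<Sum>\<alpha>\<in>S. e \<alpha> * \<alpha> ^ i) \<le> fact i * M / \<sigma> ^ i" for i
  proof -
    have "norm ((deriv ^^ i) (expsum S c) t) \<le> fact i * M / \<sigma> ^ i"
      using M \<sigma> by (intro Cauchy_inequality holomorphic_intros continuous_on_expsum)
        (auto simp: dist_norm)
    then show ?thesis
      unfolding expsum_higher_deriv by (simp add: expsum_def e_def mult_ac)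
  qed
  have wt: "norm (w - t) \<le> \<rho>" using w by (simp add: dist_norm norm_minus_commute)
  have le: "norm (w - t) ^ i / fact i * norm (\<Sum>\<alpha>\<in>S. e \<alpha> * \<alpha> ^ i) \<le> (\<rho> / \<sigma>) ^ (card S - 1) * M"
    if i: "i < card S" for i
  proof -
    have "norm (w - t) ^ i / fact i * norm (\<Sum>\<alpha>\<in>S. e \<alpha> * \<alpha> ^ i) \<le>
        \<rho> ^ i / fact i * (fact i * M / \<sigma> ^ i)"
      using wt \<sigma> M0 by (intro mult_mono b divide_right_mono power_mono) auto
    also have "\<dots> = (\<rho> / \<sigma>) ^ i * M" by (simp add: power_divide)
    also have "\<dots> \<le> (\<rho> / \<sigma>) ^ (card S - 1) * M"
      using \<sigma> i M0 by (intro mult_right_mono power_increasing) auto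
    finally show ?thesis .
  qed
  have "expsum S c w = expsum S e (w - t)"
    using expsum_shift[of S c t "w - t"] by (simp add: e_def)
  also have "norm \<dots> \<le> exp (2 * d * norm (w - t)) *
      (\<Sum>i<card S. norm (w - t) ^ i / fact i * norm (\<Sum>\<alpha>\<in>S. e \<alpha> * \<alpha> ^ i))"
    using S by (intro expsum_bound_Taylor) auto
  also have "\<dots> \<le> exp (2 * d * \<rho>) * (\<Sum>i<card S. (\<rho> / \<sigma>) ^ (card S - 1) * M)"
    using wt d by (intro mult_mono sum_mono le sum_nonneg) (auto simp: mult_left_mono)
  finally show ?thesis by (simp add: mult_ac)
qed

section \<open>Harnack's inequality and factorization\<close>

text \<open>Schwarz's lemma for the Cayley transform of \<open>\<phi>\<close>.\<close>

lemma deriv_bound_Re_pos: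
  assumes hol: "\<phi> holomorphic_on ball z \<rho>" and \<rho>: "\<rho> > 0"
    and pos: "\<And>w. w \<in> ball z \<rho> \<Longrightarrow> Re (\<phi> w) > 0"
  shows "norm (deriv \<phi> z) \<le> 2 * Re (\<phi> z) / \<rho>"
proof -
  define a where "a = \<phi> z"
  have a: "Re a > 0" using pos[of z] \<rho> by (simp add: a_def)
  define \<psi> where "\<psi> \<zeta> = (\<phi> (z + of_real \<rho> * \<zeta>) - a) / (\<phi> (z + of_real \<rho> * \<zeta>) + cnj a)" for \<zeta>
  have in_ball: "z + of_real \<rho> * \<zeta> \<in> ball z \<rho>" if "norm \<zeta> < 1" for \<zeta> :: complex
    using that \<rho> by (simp add: dist_norm norm_mult)
  have nz: "\<phi> (z + of_real \<rho> * \<zeta>) + cnj a \<noteq> 0" if "norm \<zeta> < 1" for \<zeta> :: complex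
    using pos[OF in_ball[OF that]] a by (auto simp: complex_eq_iff)
  have comp: "(\<lambda>\<zeta>. \<phi> (z + of_real \<rho> * \<zeta>)) holomorphic_on ball 0 1"
    using holomorphic_on_compose_gen[of "\<lambda>\<zeta>. z + of_real \<rho> * \<zeta>" "ball 0 1" \<phi> "ball z \<rho>"] hol in_ball
    by (force simp: o_def intro!: holomorphic_intros)
  have "\<psi> holomorphic_on ball 0 1"
    unfolding \<psi>_def using nz by (intro holomorphic_intros comp) auto
  moreover have "\<psi> 0 = 0" by (simp add: \<psi>_def a_def)
  moreover have "norm (\<psi> \<zeta>) < 1" if "norm \<zeta> < 1" for \<zeta>
  proof -
    define b where "b = \<phi> (z + of_real \<rho> * \<zeta>)"
    have b: "Re b > 0" using pos[OF in_ball[OF that]] by (simp add: b_def)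
    have "(norm (b - a))\<^sup>2 < (norm (b + cnj a))\<^sup>2"
      using mult_pos_pos[OF a b] unfolding cmod_power2 by (simp add: power2_eq_square algebra_simps)
    then have "norm (b - a) < norm (b + cnj a)" by (rule power_less_imp_less_base) simp
    then show ?thesis unfolding \<psi>_def b_def[symmetric] norm_divide
      by (metis divide_less_eq_1 norm_ge_zero order_le_less_trans)
  qed
  ultimately have "norm (deriv \<psi> 0) \<le> 1"
    using Schwarz_Lemma(2)[of \<psi> 0] by simp
  moreover have "(\<psi> has_field_derivative (of_real \<rho> * deriv \<phi> z / (a + cnj a))) (at 0)"
  proof -
    have "(\<phi> has_field_derivative deriv \<phi> z) (at (z + of_real \<rho> * 0))"
      using hol \<rho> by (auto intro: holomorphic_derivI)
    then have "((\<lambda>\<zeta>. \<phi> (z + of_real \<rho> * \<zeta>)) has_field_derivative deriv \<phi> z * of_real \<rho>) (at 0)"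
      by (rule DERIV_chain2) (auto intro!: derivative_eq_intros)
    then show ?thesis unfolding \<psi>_def
      using nz[of 0] by (auto intro!: derivative_eq_intros simp: a_def divide_simps)
  qed
  ultimately have "norm (of_real \<rho> * deriv \<phi> z / (a + cnj a)) \<le> 1"
    using DERIV_imp_deriv by fastforce
  then show ?thesis
    using a \<rho> by (simp add: complex_add_cnj norm_mult norm_divide divide_simps a_def mult_ac)
qed

text \<open>With \<open>g\<close> a holomorphic logarithm of \<open>h\<close>, the function
  \<open>ln K - g\<close> has the positive real part \<open>ln (K / norm (h z))\<close>. The
  derivative bound on balls of radius \<open>r\<close> gives the second claim directly and the first
  by integration along the segment from \<open>w\<close> to \<open>z\<close>.\<close>

lemma harnack_nonvanishing:
  assumes hol: "h holomorphic_on ball x (2 * r)" and r: "r > 0"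
    and nz: "\<And>z. z \<in> ball x (2 * r) \<Longrightarrow> h z \<noteq> 0"
    and less: "\<And>z. z \<in> ball x (2 * r) \<Longrightarrow> norm (h z) < K"
    and w: "w \<in> cball x r" and z: "z \<in> cball x r"
  shows "ln (K / norm (h z)) \<le> exp 4 * ln (K / norm (h w))"
    and "norm (deriv h z / h z) \<le> 2 * ln (K / norm (h z)) / r"
proof -
  obtain g where g: "g holomorphic_on ball x (2 * r)" "\<And>z. z \<in> ball x (2 * r) \<Longrightarrow> exp (g z) = h z"
    using holomorphic_logarithm_exists[OF convex_ball open_ball hol nz, of x] r by auto
  define \<phi> where "\<phi> z = of_real (ln K) - g z" for z
  have sub: "cball x r \<subseteq> ball x (2 * r)" using r by (auto simp: dist_norm)
  have K: "K > 0" using less[of x] r norm_ge_zero[of "h x"] by (simp del: norm_ge_zero)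
  have Re_g: "Re (g z) = ln (norm (h z))" if "z \<in> ball x (2 * r)" for z
    using g(2)[OF that] by (metis ln_exp norm_exp_eq_Re)
  have Re_\<phi>: "Re (\<phi> z) = ln (K / norm (h z))" if "z \<in> ball x (2 * r)" for z
    using Re_g[OF that] K nz[OF that] by (simp add: \<phi>_def ln_div)
  have pos: "Re (\<phi> z) > 0" if "z \<in> ball x (2 * r)" for z
  proof -
    have "1 < K / norm (h z)" using less[OF that] nz[OF that] by (simp add: divide_simps)
    then show ?thesis unfolding Re_\<phi>[OF that] by (rule ln_gt_zero)
  qed
  have hol\<phi>: "\<phi> holomorphic_on ball x (2 * r)"
    unfolding \<phi>_def by (intro holomorphic_intros g)
  have bound: "norm (deriv \<phi> v) \<le> 2 * Re (\<phi> v) / r" if v: "v \<in> cball x r" for v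
  proof (rule deriv_bound_Re_pos)
    have "ball v r \<subseteq> ball x (2 * r)"
    proof
      fix y assume "y \<in> ball v r"
      then show "y \<in> ball x (2 * r)" using v dist_triangle[of x y v] by simp
    qed
    then show "\<phi> holomorphic_on ball v r" "\<And>w. w \<in> ball v r \<Longrightarrow> Re (\<phi> w) > 0"
      using hol\<phi> pos holomorphic_on_subset by blast+
  qed (fact r)
  have h_deriv: "deriv \<phi> z = - (deriv h z / h z)"
  proof -
    have zin: "z \<in> ball x (2 * r)" using z sub by auto
    have "(g has_field_derivative deriv g z) (at z)"
      using g(1) zin by (auto intro: holomorphic_derivI)
    then have 1: "(\<phi> has_field_derivative - deriv g z) (at z)"
      unfolding \<phi>_def by (auto intro!: derivative_eq_intros)
    have "((\<lambda>z. exp (g z)) has_field_derivative exp (g z) * deriv g z) (at z)"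
      using \<open>(g has_field_derivative deriv g z) (at z)\<close> by (auto intro!: derivative_eq_intros)
    then have "(h has_field_derivative exp (g z) * deriv g z) (at z)"
      using has_field_derivative_transform_within_open[OF _ open_ball zin] g(2) by blast
    then have "deriv h z = h z * deriv g z"
      using g(2)[OF zin] DERIV_imp_deriv by fastforce
    then show ?thesis using DERIV_imp_deriv[OF 1] nz[OF zin] by simp
  qed
  show "norm (deriv h z / h z) \<le> 2 * ln (K / norm (h z)) / r"
    using bound[OF z] Re_\<phi>[of z] sub z unfolding h_deriv by auto
  \<comment> \<open>The derivative of \<phi> is bounded only relative to \<open>Re \<phi>\<close>,
    so it is the logarithm of \<open>Re \<phi>\<close> that has a bounded derivative along the
    segment.\<close>
  define u where "u s = ln (Re (\<phi> (w + of_real s * (z - w))))" for s :: real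
  define u' where "u' s = Re (deriv \<phi> (w + of_real s * (z - w)) * (z - w)) / Re (\<phi> (w + of_real s * (z - w)))" for s :: real
  have seg: "w + of_real s * (z - w) \<in> cball x r" if "0 \<le> s" "s \<le> 1" for s :: real
  proof -
    have "(1 - s) *\<^sub>R w + s *\<^sub>R z \<in> cball x r"
      using convex_cball w z that by (intro convexD) auto
    then show ?thesis by (simp add: scaleR_conv_of_real algebra_simps)
  qed
  have u_deriv: "(u has_real_derivative u' s) (at s)" if s: "0 \<le> s" "s \<le> 1" for s
  proof -
    have "(\<phi> has_field_derivative deriv \<phi> (w + of_real s * (z - w))) (at (w + of_real s * (z - w)))"
      using hol\<phi> seg[OF s] sub by (intro holomorphic_derivI[OF _ open_ball]) auto
    then have "((\<lambda>\<zeta>. \<phi> (w + \<zeta> * (z - w))) has_field_derivative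
         deriv \<phi> (w + of_real s * (z - w)) * (z - w)) (at (of_real s))"
      by (rule DERIV_chain2) (auto intro!: derivative_eq_intros)
    from has_vector_derivative_real_field[OF this]
    have "((\<lambda>s. Re (\<phi> (w + of_real s * (z - w)))) has_real_derivative
         Re (deriv \<phi> (w + of_real s * (z - w)) * (z - w))) (at s)"
      by (rule has_vector_derivative_complex_iff[THEN iffD1, THEN conjunct1])
    moreover have "Re (\<phi> (w + of_real s * (z - w))) > 0"
      using pos seg[OF s] sub by blast
    ultimately show ?thesis unfolding u_def u'_def
      using DERIV_chain2[OF DERIV_ln_divide] by fastforce
  qed
  \<comment> \<open>The 4 is the product of \<open>2 / r\<close> from the derivative bound and
    \<open>2 * r\<close>, which bounds the length of the segment.\<close>
  have "\<bar>u' s\<bar> \<le> 4" if s: "0 \<le> s" "s \<le> 1" for s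
  proof -
    let ?v = "w + of_real s * (z - w)"
    have p: "Re (\<phi> ?v) > 0" using pos seg[OF s] sub by blast
    have "norm (z - w) \<le> 2 * r" using w z by (simp add: dist_norm) norm
    then have "norm (deriv \<phi> ?v * (z - w)) \<le> (2 * Re (\<phi> ?v) / r) * (2 * r)"
      unfolding norm_mult using bound[OF seg[OF s]] p r by (intro mult_mono) auto
    then have "\<bar>Re (deriv \<phi> ?v * (z - w))\<bar> \<le> 4 * Re (\<phi> ?v)"
      using r abs_Re_le_cmod[of "deriv \<phi> ?v * (z - w)"] by simp
    then show ?thesis using p by (simp add: u'_def divide_simps)
  qed
  then have "\<bar>u 1 - u 0\<bar> \<le> 4 * \<bar>1 - 0\<bar>"
    using field_differentiable_bound[of "{0..1}" u u' 4 1 0] u_deriv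
    by (auto simp: has_field_derivative_at_within)
  then have "u 1 \<le> 4 + u 0" by simp
  then have "exp (u 1) \<le> exp 4 * exp (u 0)" by (simp add: exp_add[symmetric])
  then show "ln (K / norm (h z)) \<le> exp 4 * ln (K / norm (h w))"
    using Re_\<phi>[of z] Re_\<phi>[of w] pos[of z] pos[of w] w z subsetD[OF sub, of w] subsetD[OF sub, of z]
    by (simp add: u_def)
qed

section \<open>Splitting off zeros\<close>

lemma holomorphic_divide_zero:
  assumes "g holomorphic_on A" "open A" "a \<in> A" "g a = 0"
  obtains k where "k holomorphic_on A" "\<And>z. z \<in> A \<Longrightarrow> g z = (z - a) * k z"
proof
  let ?k = "\<lambda>z. if z = a then deriv g a else (g z - g a) / (z - a)"
  show "?k holomorphic_on A"
    using assms by (intro pole_lemma) (auto simp: interior_open)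
  show "g z = (z - a) * ?k z" for z using assms by simp
qed

text \<open>A count in the manner of Jensen. On the circle of radius \<open>6 * r\<close> each
  factor \<open>v - z k\<close> has norm at least \<open>4 * r\<close>, so the maximum principle
  bounds \<open>h\<close> by \<open>M / (4 * r) ^ N\<close>; at \<open>w\<close> each factor has
  norm at most \<open>3 * r\<close>. Every zero thus costs a factor 3/4, and only
  \<open>exp (- B)\<close> is available in total.\<close>

lemma factorization_bound:
  assumes A: "open A" "cball x (6 * r) \<subseteq> A" and f: "f holomorphic_on A"
    and r: "r > 0" and M: "\<And>v. v \<in> cball x (6 * r) \<Longrightarrow> norm (f v) \<le> M"
    and w: "w \<in> cball x r" "norm (f w) \<ge> M * exp (- B)" and M0: "M > 0"
    and z: "\<And>k. k < N \<Longrightarrow> z k \<in> cball x (2 * r)"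
    and h: "h holomorphic_on A" "\<And>v. v \<in> A \<Longrightarrow> f v = (\<Prod>k<N. v - z k) * h v"
  shows "real N \<le> 4 * B" "\<And>v. v \<in> cball x (2 * r) \<Longrightarrow> norm (h v) \<le> norm (h w) * exp B"
proof -
  have bd: "norm (h v) \<le> M / (4 * r) ^ N" if v: "v \<in> cball x (6 * r)" for v
  proof (rule maximum_modulus_frontier[of h "cball x (6 * r)"])
    show "h holomorphic_on interior (cball x (6 * r))"
      using h(1) A interior_subset by (meson holomorphic_on_subset order_trans)
    show "continuous_on (closure (cball x (6 * r))) h"
      using h(1) A by (auto intro: holomorphic_on_imp_continuous_on holomorphic_on_subset)
    fix v assume "v \<in> frontier (cball x (6 * r))"
    then have v: "dist x v = 6 * r" using r by simp
    have "(4 * r) ^ N \<le> (\<Prod>k<N. norm (v - z k))"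
    proof -
      have "4 * r \<le> norm (v - z k)" if "k < N" for k
        using z[OF that] v dist_triangle[of x v "z k"] by (simp add: dist_norm norm_minus_commute)
      then have "(\<Prod>k<N. 4 * r) \<le> (\<Prod>k<N. norm (v - z k))"
        using r by (intro prod_mono) auto
      then show ?thesis by simp
    qed
    moreover have "norm (f v) = (\<Prod>k<N. norm (v - z k)) * norm (h v)"
      using h(2)[of v] A(2) v by (subst prod_norm) (auto simp: norm_mult subset_iff)
    ultimately have "(4 * r) ^ N * norm (h v) \<le> norm (f v)"
      by (simp add: mult_right_mono)
    also have "\<dots> \<le> M" using M v by simp
    finally show "norm (h v) \<le> M / (4 * r) ^ N" using r by (simp add: field_simps)
  qed (use v in auto)
  have "norm (f w) \<le> (3 * r) ^ N * norm (h w)"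
  proof -
    have "(\<Prod>k<N. norm (w - z k)) \<le> (\<Prod>k<N. 3 * r)"
    proof (rule prod_mono)
      fix k assume "k \<in> {..<N}"
      then show "0 \<le> norm (w - z k) \<and> norm (w - z k) \<le> 3 * r"
        using z[of k] w by (simp add: dist_norm) norm
    qed
    moreover have "w \<in> A" using w A r by auto
    ultimately show ?thesis
      using h(2)[of w] by (simp add: norm_mult prod_norm[symmetric] mult_right_mono)
  qed
  then have hw: "M * exp (- B) \<le> (3 * r) ^ N * norm (h w)" using w by simp
  have "norm (h w) \<le> M / (4 * r) ^ N" using bd w r by simp
  then have "M * exp (- B) \<le> (3 * r) ^ N * (M / (4 * r) ^ N)"
    using hw r by (smt (verit) mult_left_mono zero_le_power)
  also have "\<dots> = M * (3 / 4) ^ N" using r by (simp add: power_mult_distrib power_divide)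
  finally have e: "exp (- B) \<le> (3 / 4) ^ N" using M0 by simp
  \<comment> \<open>As 3/4 = 1 - 1/4 is at most \<open>exp (- (1/4))\<close>, the bound becomes
    linear in \<open>N\<close>; this is the factor 4 in the count.\<close>
  have "exp (- B) \<le> exp (- (1/4)) ^ N"
  proof -
    have "(3/4::real) \<le> exp (- (1/4))" using exp_ge_add_one_self[of "- (1/4)::real"] by simp
    then show ?thesis using e power_mono[of "3/4::real" "exp (- (1/4))" N] by simp
  qed
  then have "exp (- B) \<le> exp (- (real N / 4))" by (simp add: exp_of_nat_mult[symmetric])
  then show "real N \<le> 4 * B" by simp
  fix v assume "v \<in> cball x (2 * r)"
  then have "norm (h v) \<le> M / (4 * r) ^ N" using bd r by simp
  also have "M \<le> (3 * r) ^ N * norm (h w) * exp B"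
    using hw by (simp add: exp_minus field_simps)
  then have "M / (4 * r) ^ N \<le> (3 * r) ^ N * norm (h w) * exp B / (4 * r) ^ N"
    using r by (intro divide_right_mono) auto
  also have "\<dots> = (3 / 4) ^ N * (norm (h w) * exp B)"
    using r by (simp add: power_mult_distrib power_divide)
  also have "\<dots> \<le> 1 * (norm (h w) * exp B)"
    by (intro mult_right_mono power_le_one) auto
  finally show "norm (h v) \<le> norm (h w) * exp B" by simp
qed

text \<open>Zeros in the disc of radius \<open>2 * r\<close> are split off as long as possible. The
  count above stops the process, and the remaining factor has no zero in that disc, so Harnack's
  inequality controls its oscillation and its logarithmic derivative on the disc of radius
  \<open>r\<close>.\<close>

lemma controlled_factorization:
  assumes A: "open A" "cball x (6 * r) \<subseteq> A" and f: "f holomorphic_on A"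
    and r: "r > 0" and M: "\<And>v. v \<in> cball x (6 * r) \<Longrightarrow> norm (f v) \<le> M"
    and w: "w \<in> cball x r" "norm (f w) \<ge> M * exp (- B)" and M0: "M > 0"
  obtains N z h where "real N \<le> 4 * B"
    "h holomorphic_on A" "\<And>v. v \<in> A \<Longrightarrow> f v = (\<Prod>k<N. v - z k) * h v"
    "\<And>v. v \<in> cball x r \<Longrightarrow> h v \<noteq> 0"
    "\<And>u v. u \<in> cball x r \<Longrightarrow> v \<in> cball x r \<Longrightarrow> norm (h u) \<le> norm (h v) * exp (exp 4 * (B + 1))"
    "\<And>v. v \<in> cball x r \<Longrightarrow> norm (deriv h v / h v) \<le> 2 * exp 4 * (B + 1) / r"
proof -
  \<comment> \<open>The \<open>z k\<close> may repeat, so zeros are counted with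
    multiplicity.\<close>
  define P where "P N \<longleftrightarrow> (\<exists>z h. (\<forall>k<N. z k \<in> cball x (2 * r)) \<and> h holomorphic_on A \<and>
      (\<forall>v\<in>A. f v = (\<Prod>k<N. v - z k) * h v))" for N :: nat
  have "P 0" using f by (auto simp: P_def)
  have bdd: "N \<le> nat \<lfloor>4 * B\<rfloor>" if "P N" for N
  proof -
    from that obtain z h where "\<And>k. k < N \<Longrightarrow> z k \<in> cball x (2 * r)" "h holomorphic_on A"
      "\<And>v. v \<in> A \<Longrightarrow> f v = (\<Prod>k<N. v - z k) * h v" unfolding P_def by blast
    from factorization_bound(1)[OF A f r M w M0 this] have "real N \<le> 4 * B" by simp
    then show ?thesis by linarith
  qed
  define N where "N = (GREATEST N. P N)"
  have "P N" and N: "\<And>m. P m \<Longrightarrow> m \<le> N"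
    unfolding N_def using \<open>P 0\<close> bdd by (auto intro: GreatestI_nat Greatest_le_nat)
  then obtain z h where z: "\<And>k. k < N \<Longrightarrow> z k \<in> cball x (2 * r)" and h: "h holomorphic_on A"
      "\<And>v. v \<in> A \<Longrightarrow> f v = (\<Prod>k<N. v - z k) * h v" unfolding P_def by blast
  note bounds = factorization_bound[OF A f r M w M0 z h]
  have sub: "cball x r \<subseteq> ball x (2 * r)" "cball x (2 * r) \<subseteq> A" "ball x (2 * r) \<subseteq> A"
    using A r by (auto simp: dist_norm)
  have nz: "h v \<noteq> 0" if v: "v \<in> cball x (2 * r)" for v
  proof
    assume "h v = 0"
    then obtain k where k: "k holomorphic_on A" "\<And>y. y \<in> A \<Longrightarrow> h y = (y - v) * k y"
      using holomorphic_divide_zero[OF h(1) A(1)] v sub by blast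
    have "P (Suc N)" unfolding P_def
      by (rule exI[of _ "z(N := v)"], rule exI[of _ k])
        (use z v k h(2) in \<open>auto simp: less_Suc_eq\<close>)
    then show False using N by force
  qed
  have hw: "h w \<noteq> 0" "w \<in> ball x (2 * r)" using nz w sub by auto
  \<comment> \<open>The extra 1 in the exponent makes the bound on \<open>h\<close> strict, as
    Harnack's inequality requires; it is the source of \<open>B + 1\<close> in the
    conclusions.\<close>
  define K where "K = norm (h w) * exp (B + 1)"
  have K: "norm (h v) < K" if "v \<in> ball x (2 * r)" for v
  proof -
    have "norm (h v) \<le> norm (h w) * exp B" using bounds(2) that by simp
    also have "\<dots> < K" using hw by (simp add: K_def)
    finally show ?thesis .
  qed
  have "h holomorphic_on ball x (2 * r)" using h(1) sub holomorphic_on_subset by blast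
  note harnack = harnack_nonvanishing[OF this r nz K w(1)]
  have lnw: "ln (K / norm (h w)) = B + 1" using hw by (simp add: K_def)
  have l: "ln (K / norm (h v)) \<le> exp 4 * (B + 1)" if "v \<in> cball x r" for v
    using harnack(1)[OF _ _ that] lnw by auto
  show ?thesis
  proof (rule that[OF bounds(1) h])
    show "h v \<noteq> 0" if "v \<in> cball x r" for v using nz that sub by auto
    show "norm (h u) \<le> norm (h v) * exp (exp 4 * (B + 1))" if "u \<in> cball x r" "v \<in> cball x r" for u v
    proof -
      have hv: "h v \<noteq> 0" and "K > 0" using nz[of v] that sub hw by (auto simp: K_def)
      then have "K / norm (h v) = exp (ln (K / norm (h v)))" by simp
      also have "\<dots> \<le> exp (exp 4 * (B + 1))" using l[OF that(2)] by simp
      finally have "K \<le> norm (h v) * exp (exp 4 * (B + 1))" using hv by (simp add: field_simps)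
      then show ?thesis using K[of u] that sub by auto
    qed
    show "norm (deriv h v / h v) \<le> 2 * exp 4 * (B + 1) / r" if "v \<in> cball x r" for v
    proof -
      have "norm (deriv h v / h v) \<le> 2 * ln (K / norm (h v)) / r"
        using harnack(2)[OF _ _ that] by auto
      also have "\<dots> \<le> 2 * (exp 4 * (B + 1)) / r"
        using l[OF that] r by (simp add: divide_right_mono)
      finally show ?thesis by (simp add: mult_ac)
    qed
  qed
qed

section \<open>Logarithmic integrals\<close>

text \<open>Since the integrand is nonnegative, a bound for a whole interval passes to every
  Lebesgue measurable subset.\<close>

lemma set_integral_le_nn_integral:
  fixes f :: "real \<Rightarrow> real"
  assumes f: "f \<in> borel_measurable borel" "\<And>t. f t \<ge> 0"
    and I: "(\<integral>\<^sup>+t. ennreal (f t) * indicator {x..y} t \<partial>lborel) \<le> ennreal C" "C \<ge> 0"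
    and E: "E \<subseteq> {x..y}" "E \<in> sets lebesgue"
  shows "set_integrable lebesgue E f" "(LINT t:E|lebesgue. f t) \<le> C"
proof -
  have f': "f \<in> borel_measurable lebesgue"
    using f(1) by (simp add: borel_measurable_if measurable_completion)
  have m: "(\<lambda>t. indicator E t *\<^sub>R f t) \<in> borel_measurable lebesgue"
    using f' E(2) by simp
  have "(\<integral>\<^sup>+t. ennreal (indicator E t *\<^sub>R f t) \<partial>lebesgue) \<le>
      (\<integral>\<^sup>+t. ennreal (f t) * indicator {x..y} t \<partial>lebesgue)"
    using E(1) by (intro nn_integral_mono) (auto simp: indicator_def)
  also have "\<dots> \<le> ennreal C" using I by (simp add: nn_integral_completion)
  finally have nn: "(\<integral>\<^sup>+t. ennreal (indicator E t *\<^sub>R f t) \<partial>lebesgue) \<le> ennreal C" .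
  have int: "integrable lebesgue (\<lambda>t. indicator E t *\<^sub>R f t)"
    using m f(2) le_less_trans[OF nn ennreal_less_top] by (intro integrableI_nonneg) auto
  then show "set_integrable lebesgue E f" by (simp add: set_integrable_def)
  have "ennreal (LINT t:E|lebesgue. f t) = (\<integral>\<^sup>+t. ennreal (indicator E t *\<^sub>R f t) \<partial>lebesgue)"
    unfolding set_lebesgue_integral_def
    by (rule nn_integral_eq_integral[symmetric, OF int]) (use f(2) in auto)
  with nn have "ennreal (LINT t:E|lebesgue. f t) \<le> ennreal C" by simp
  then show "(LINT t:E|lebesgue. f t) \<le> C" using I(2) by simp
qed

text \<open>When \<open>w k\<close> is not above \<open>z\<close>, the number
  \<open>1 / (z - w k)\<close> lies in the closed lower half-plane, which multiplication by \<i>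
  turns into the right one. The case \<open>z = w k\<close> is harmless because division by zero
  yields 0.\<close>

lemma Re_cauchy_sum_nonneg:
  assumes "\<And>k. k \<in> K \<Longrightarrow> Im (w k) \<le> Im z" "a \<ge> 0"
  shows "Re (\<i> * of_real a * (\<Sum>k\<in>K. 1 / (z - w k))) \<ge> 0"
proof -
  have "Im (1 / (z - w k)) \<le> 0" if "k \<in> K" for k
    using assms(1)[OF that] by (simp add: Im_divide divide_nonpos_nonneg)
  then have "Im (\<Sum>k\<in>K. 1 / (z - w k)) \<le> 0" by (simp add: sum_nonpos)
  then show ?thesis using assms(2) by (simp add: mult_nonneg_nonpos)
qed

text \<open>The sum maps the upper half-plane into the lower one, so the logarithm is holomorphic there,
  and its integral over a large real interval equals the one over a large semicircle, on which the
  sum is of size \<open>card K / R\<close>.\<close>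

lemma log_cauchy_sum_integral_off_axis:
  fixes w :: "'k \<Rightarrow> complex"
  assumes K: "finite K" and w: "\<And>k. k \<in> K \<Longrightarrow> Im (w k) < 0" and a: "a > 0"
  shows "(\<integral>\<^sup>+t. ennreal (ln (norm (1 + \<i> * of_real a * (\<Sum>k\<in>K. 1 / (of_real t - w k))))) *
      indicator {x..y} t \<partial>lborel) \<le> ennreal (4 * pi * a * real (card K))"
proof -
  define G where "G z = 1 + \<i> * of_real a * (\<Sum>k\<in>K. 1 / (z - w k))" for z
  \<comment> \<open>An open half-plane, or the whole plane if \<open>K\<close> is empty. It contains
    the closed upper half-plane, and \<open>Re (G z)\<close> is at least 1 on it, so
    \<open>Ln (G z)\<close> is holomorphic across the real axis.\<close>
  define H where "H = (\<Inter>k\<in>K. {z. Im z > Im (w k)})"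
  have H: "open H" "convex H"
    unfolding H_def using K by (auto intro!: open_halfspace_Im_gt convex_INT convex_halfspace_Im_gt)
  have inH: "z \<in> H" if "Im z \<ge> 0" for z using w that unfolding H_def by fastforce
  have ReG: "Re (G z) \<ge> 1" if "z \<in> H" for z
  proof -
    have "\<And>k. k \<in> K \<Longrightarrow> Im (w k) \<le> Im z" using that unfolding H_def by fastforce
    with Re_cauchy_sum_nonneg[of K w z a] a show ?thesis unfolding G_def by simp
  qed
  have nG: "norm (G z) \<ge> 1" if "z \<in> H" for z
    using ReG[OF that] complex_Re_le_cmod[of "G z"] by linarith
  have holG: "G holomorphic_on H"
    unfolding G_def by (intro holomorphic_intros) (auto simp: H_def)
  have holL: "(\<lambda>z. Ln (G z)) holomorphic_on H"
  proof (intro holomorphic_intros holG)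
    fix z assume "z \<in> H"
    then show "G z \<notin> \<real>\<^sub>\<le>\<^sub>0" using ReG[of z] by (auto simp: complex_nonpos_Reals_iff)
  qed
  define n where "n = real (card K)"
  have n0: "n \<ge> 0" by (simp add: n_def)
  \<comment> \<open>Large enough for three purposes: \<open>{x..y}\<close> lies in
    \<open>{-R..R}\<close>, all poles have modulus at most \<open>R / 2\<close>, and on the arc
    \<open>G\<close> differs from 1 by less than 1/2, as \<open>norm_Ln_le\<close> needs.\<close>
  define R where "R = 1 + \<bar>x\<bar> + \<bar>y\<bar> + 2 * (\<Sum>k\<in>K. norm (w k)) + 4 * a * n"
  have sum0: "(\<Sum>k\<in>K. norm (w k)) \<ge> 0" by (simp add: sum_nonneg)
  have R: "R > 0" "R \<ge> \<bar>x\<bar>" "R \<ge> \<bar>y\<bar>" "R > 4 * a * n"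
    using sum0 a n0 unfolding R_def by (auto simp: add_pos_nonneg add_nonneg_nonneg add_increasing add_increasing2)
  have wR: "norm (w k) \<le> R / 2" if "k \<in> K" for k
  proof -
    have "2 * norm (w k) \<le> 2 * (\<Sum>k\<in>K. norm (w k))"
      using K that by (intro mult_left_mono member_le_sum) auto
    also have "\<dots> \<le> R"
      unfolding R_def using a n0 by (simp add: add_nonneg_nonneg)
    finally show ?thesis by simp
  qed
  let ?line = "linepath (of_real (-R)) (of_real R) :: real \<Rightarrow> complex"
  let ?arc = "part_circlepath 0 R 0 pi"
  have arc_img: "z \<in> H" "norm z = R" if "z \<in> path_image ?arc" for z
    using that R(1) inH
    by (auto simp: path_image_part_circlepath' closed_segment_eq_real_ivl norm_mult intro!: inH mult_nonneg_nonneg sin_ge_zero)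
  have line_img: "path_image ?line \<subseteq> H"
    using inH by (auto simp: path_image_def linepath_def scaleR_conv_of_real)
  have arc_bound: "norm (Ln (G z)) \<le> 4 * a * n / R" if "z \<in> path_image ?arc" for z
  proof -
    have "norm (1 / (z - w k)) \<le> 2 / R" if "k \<in> K" for k
    proof -
      have "R / 2 \<le> norm (z - w k)"
        using wR[OF that] arc_img(2)[OF \<open>z \<in> path_image ?arc\<close>] norm_triangle_ineq2[of z "w k"] by linarith
      then show ?thesis using R(1) by (simp add: norm_divide divide_simps mult_ac)
    qed
    then have "norm (\<Sum>k\<in>K. 1 / (z - w k)) \<le> n * (2 / R)"
      unfolding n_def using sum_norm_bound[of K "\<lambda>k. 1 / (z - w k)" "2 / R"] by simp
    then have "a * norm (\<Sum>k\<in>K. 1 / (z - w k)) \<le> a * (n * (2 / R))"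
      using a by (intro mult_left_mono) auto
    then have b: "norm (\<i> * of_real a * (\<Sum>k\<in>K. 1 / (z - w k))) \<le> 2 * a * n / R"
      using a by (simp add: norm_mult mult_ac)
    also have "2 * a * n / R < 1 / 2" using R by (simp add: divide_simps)
    finally have "norm (Ln (G z)) \<le> 2 * norm (\<i> * of_real a * (\<Sum>k\<in>K. 1 / (z - w k)))"
      unfolding G_def by (rule norm_Ln_le)
    also have "\<dots> \<le> 2 * (2 * a * n / R)" using b by simp
    finally show ?thesis by simp
  qed
  have "((\<lambda>z. Ln (G z)) has_contour_integral 0) (?line +++ ?arc)"
  proof (rule Cauchy_theorem_convex_simple[OF holL H(2)])
    show "path_image (?line +++ ?arc) \<subseteq> H"
      using line_img arc_img by (auto simp: path_image_join)
  qed (auto simp: valid_path_join)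
  moreover have int1: "(\<lambda>z. Ln (G z)) contour_integrable_on ?line"
    and int2: "(\<lambda>z. Ln (G z)) contour_integrable_on ?arc"
    using holL H line_img arc_img by (auto intro!: contour_integrable_holomorphic_simple)
  ultimately have "contour_integral ?line (\<lambda>z. Ln (G z)) = - contour_integral ?arc (\<lambda>z. Ln (G z))"
    by (metis add_eq_0_iff2 contour_integral_join contour_integral_unique valid_path_linepath valid_path_part_circlepath pathfinish_linepath)
  \<comment> \<open>The arc length \<open>pi * R\<close> cancels the decay \<open>1 / R\<close>, so
    the bound does not depend on \<open>R\<close>.\<close>
  moreover have "norm (contour_integral ?arc (\<lambda>z. Ln (G z))) \<le> 4 * a * n / R * R * \<bar>pi - 0\<bar>"
    using int2 arc_bound R a n0 by (intro contour_integral_bound_part_circlepath) auto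
  ultimately have bd: "norm (contour_integral ?line (\<lambda>z. Ln (G z))) \<le> 4 * pi * a * n"
    using R by (simp add: mult_ac)
  define I where "I = contour_integral ?line (\<lambda>z. Ln (G z))"
  have "((\<lambda>t. Ln (G (of_real t))) has_integral I) {-R..R}"
    using has_contour_integral_linepath_Reals_iff[of "of_real (-R)" "of_real R" "\<lambda>z. Ln (G z)" I]
      has_contour_integral_integral[OF int1] R unfolding I_def by simp
  then have "((\<lambda>t. Re (Ln (G (of_real t)))) has_integral Re I) {-R..R}" by (rule has_integral_Re)
  moreover have "Re (Ln (G (of_real t))) = ln (norm (G (of_real t)))" for t :: real
    using nG[OF inH, of "of_real t"] by (intro Re_Ln) auto
  ultimately have "((\<lambda>t. ln (norm (G (of_real t)))) has_integral Re I) {-R..R}" by simp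
  then have eq: "(\<integral>\<^sup>+t. ennreal (ln (norm (G (of_real t)))) * indicator {-R..R} t \<partial>lborel) = ennreal (Re I)"
    using nG[OF inH] by (intro nn_integral_has_integral_lebesgue') auto
  have "(\<integral>\<^sup>+t. ennreal (ln (norm (G (of_real t)))) * indicator {x..y} t \<partial>lborel) \<le>
     (\<integral>\<^sup>+t. ennreal (ln (norm (G (of_real t)))) * indicator {-R..R} t \<partial>lborel)"
    using R by (intro nn_integral_mono mult_left_mono) (auto simp: indicator_def)
  also note eq
  also have "ennreal (Re I) \<le> ennreal (4 * pi * a * n)"
    using bd complex_Re_le_cmod[of I] unfolding I_def by (intro ennreal_leI) linarith
  finally show ?thesis unfolding G_def n_def .
qed

text \<open>Poles on the real axis are handled by pushing all poles down by \<open>1 / (j + 1)\<close> and using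
  Fatou's lemma.\<close>

lemma log_cauchy_sum_integral:
  fixes w :: "'k \<Rightarrow> complex"
  assumes K: "finite K" and w: "\<And>k. k \<in> K \<Longrightarrow> Im (w k) \<le> 0" and a: "a > 0"
  shows "(\<integral>\<^sup>+t. ennreal (ln (norm (1 + \<i> * of_real a * (\<Sum>k\<in>K. 1 / (of_real t - w k))))) *
      indicator {x..y} t \<partial>lborel) \<le> ennreal (4 * pi * a * real (card K))"
proof -
  define G where "G z = 1 + \<i> * of_real a * (\<Sum>k\<in>K. 1 / (z - w k))" for z
  define v where "v j t = of_real t + \<i> * of_real (1 / real (Suc j))" for j and t :: real
  define u where "u j t = ennreal (ln (norm (G (v j t)))) * indicator {x..y} t" for j and t :: real
  define u0 where "u0 t = ennreal (ln (norm (G (of_real t)))) * indicator {x..y} t" for t :: real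
  have lim: "(\<lambda>j. u j t) \<longlonglongrightarrow> u0 t" if t: "of_real t \<notin> w ` K" for t
  proof -
    have "(\<lambda>j. 1 / real (Suc j)) \<longlonglongrightarrow> 0"
      using LIMSEQ_inverse_real_of_nat by (simp add: inverse_eq_divide)
    then have "(\<lambda>j. v j t) \<longlonglongrightarrow> of_real t + \<i> * of_real 0"
      unfolding v_def by (intro tendsto_intros)
    then have vl: "(\<lambda>j. v j t) \<longlonglongrightarrow> of_real t" by simp
    have "(\<lambda>j. G (v j t)) \<longlonglongrightarrow> G (of_real t)"
      unfolding G_def using t by (intro tendsto_intros vl) auto
    moreover have "Re (G (of_real t)) \<ge> 1"
      using Re_cauchy_sum_nonneg[of K w "of_real t" a] w a unfolding G_def by simp
    then have "G (of_real t) \<noteq> 0" by auto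
    ultimately have "(\<lambda>j. ln (norm (G (v j t)))) \<longlonglongrightarrow> ln (norm (G (of_real t)))"
      by (intro tendsto_intros) auto
    then have "(\<lambda>j. ennreal (ln (norm (G (v j t))))) \<longlonglongrightarrow> ennreal (ln (norm (G (of_real t))))"
      by (rule tendsto_ennrealI)
    then show ?thesis unfolding u_def u0_def by (auto simp: indicator_def)
  qed
  have "finite {t. of_real t \<in> w ` K}"
    using K finite_vimageI[of "w ` K" "of_real :: real \<Rightarrow> complex"]
    by (simp add: vimage_def inj_of_real)
  then have "AE t in lborel. t \<notin> {t. of_real t \<in> w ` K}"
    by (intro AE_not_in) (simp add: finite_imp_null_set_lborel)
  then have "AE t in lborel. u0 t = liminf (\<lambda>j. u j t)"
  proof eventually_elim
    case (elim t)
    then show ?case using lim_imp_Liminf[OF _ lim, of t] by simp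
  qed
  then have "(\<integral>\<^sup>+t. u0 t \<partial>lborel) = (\<integral>\<^sup>+t. liminf (\<lambda>j. u j t) \<partial>lborel)"
    by (rule nn_integral_cong_AE)
  also have "\<dots> \<le> liminf (\<lambda>j. \<integral>\<^sup>+t. u j t \<partial>lborel)"
    by (rule nn_integral_liminf) (simp add: u_def G_def v_def)
  also have "\<dots> \<le> liminf (\<lambda>j::nat. ennreal (4 * pi * a * real (card K)))"
  proof (intro Liminf_mono always_eventually allI)
    fix j
    have eq: "v j t - w k = of_real t - (w k - \<i> * of_real (1 / real (Suc j)))" for k t
      by (simp add: v_def)
    show "(\<integral>\<^sup>+t. u j t \<partial>lborel) \<le> ennreal (4 * pi * a * real (card K))"
      unfolding u_def G_def eq
      using w by (intro log_cauchy_sum_integral_off_axis K a) (auto intro: order_le_less_trans[of _ 0])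
  qed
  also have "\<dots> = ennreal (4 * pi * a * real (card K))" by (simp add: Liminf_const)
  finally show ?thesis unfolding u0_def G_def .
qed

text \<open>Let \<open>F\<close> be the sum times \<i> and \<open>a\<close>. Since
  \<open>Re F \<ge> 0\<close>, both 1 and \<open>norm F\<close> are at most
  \<open>norm (1 + F)\<close>, which is \<open>exp u\<close>; so the size of the sum itself is
  controlled by a function with a small integral.\<close>

lemma log_cauchy_sum_bounds:
  fixes w :: "'k \<Rightarrow> complex" and a :: real
  assumes K: "finite K" and w: "\<And>k. k \<in> K \<Longrightarrow> Im (w k) \<le> 0" and a: "a > 0"
    and E: "E \<subseteq> {x..y}" "E \<in> sets lebesgue"
  defines "u \<equiv> \<lambda>t::real. ln (norm (1 + \<i> * of_real a * (\<Sum>k\<in>K. 1 / (of_real t - w k))))"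
  shows "set_integrable lebesgue E u" "(LINT t:E|lebesgue. u t) \<le> 4 * pi * a * real (card K)"
    "1 + a * norm (\<Sum>k\<in>K. 1 / (of_real t - w k)) \<le> 2 * exp (u t)"
proof -
  define F where "F t = \<i> * of_real a * (\<Sum>k\<in>K. 1 / (of_real t - w k))" for t :: real
  have Re: "Re (F t) \<ge> 0" for t
    unfolding F_def using w a by (intro Re_cauchy_sum_nonneg) auto
  have n1: "norm (1 + F t) \<ge> 1" for t
    using Re[of t] complex_Re_le_cmod[of "1 + F t"] by simp
  have u: "u t = ln (norm (1 + F t))" for t by (simp add: u_def F_def)
  have "u \<in> borel_measurable borel" unfolding u_def by measurable
  moreover have "u t \<ge> 0" for t using n1 by (simp add: u)
  moreover have "(\<integral>\<^sup>+t. ennreal (u t) * indicator {x..y} t \<partial>lborel) \<le> ennreal (4 * pi * a * real (card K))"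
    unfolding u_def by (rule log_cauchy_sum_integral[OF K w a])
  ultimately show "set_integrable lebesgue E u" "(LINT t:E|lebesgue. u t) \<le> 4 * pi * a * real (card K)"
    using set_integral_le_nn_integral[OF _ _ _ _ E] a by auto
  have "norm (F t) \<le> norm (1 + F t)"
  proof (rule power2_le_imp_le)
    show "(norm (F t))\<^sup>2 \<le> (norm (1 + F t))\<^sup>2"
      unfolding cmod_power2 using Re[of t] by (simp add: power2_eq_square algebra_simps)
  qed simp
  moreover have "norm (F t) = a * norm (\<Sum>k\<in>K. 1 / (of_real t - w k))"
    using a by (simp add: F_def norm_mult)
  moreover have "exp (u t) = norm (1 + F t)"
    unfolding u using n1[of t] by (intro exp_ln) linarith
  ultimately show "1 + a * norm (\<Sum>k\<in>K. 1 / (of_real t - w k)) \<le> 2 * exp (u t)"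
    using n1[of t] by linarith
qed

text \<open>The logarithm is at most \<open>2 * sqrt (\<sigma> / \<bar>t - Re w\<bar>)\<close>,
  whose integral over the interval of radius \<sigma> about \<open>Re w\<close> is
  \<open>8 * \<sigma>\<close>; outside that interval the integrand vanishes.\<close>

lemma log_distance_integral:
  fixes E :: "real set" and w :: complex
  assumes \<sigma>: "\<sigma> > 0" and E: "E \<subseteq> {x..y}" "E \<in> sets lebesgue"
  defines "u \<equiv> \<lambda>t. ln (max 1 (\<sigma> / norm (of_real t - w)))"
  shows "set_integrable lebesgue E u" "(LINT t:E|lebesgue. u t) \<le> 8 * \<sigma>"
proof -
  define b where "b = Re w"
  define g where "g s = 2 * sqrt (\<sigma> / \<bar>s - b\<bar>)" for s
  have right: "(g has_integral (4 * sqrt \<sigma> * sqrt (b + \<sigma> - b) - 4 * sqrt \<sigma> * sqrt (b - b))) {b..b + \<sigma>}"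
  proof (rule fundamental_theorem_of_calculus_interior)
    fix s assume "s \<in> {b<..<b + \<sigma>}"
    then show "((\<lambda>s. 4 * sqrt \<sigma> * sqrt (s - b)) has_vector_derivative g s) (at s)"
      unfolding has_real_derivative_iff_has_vector_derivative[symmetric]
      by (auto intro!: derivative_eq_intros simp: g_def real_sqrt_divide divide_simps)
  qed (use \<sigma> in \<open>auto intro!: continuous_intros\<close>)
  have left: "(g has_integral (- 4 * sqrt \<sigma> * sqrt (b - b) - - 4 * sqrt \<sigma> * sqrt (b - (b - \<sigma>)))) {b - \<sigma>..b}"
  proof (rule fundamental_theorem_of_calculus_interior)
    fix s assume "s \<in> {b - \<sigma><..<b}"
    then show "((\<lambda>s. - 4 * sqrt \<sigma> * sqrt (b - s)) has_vector_derivative g s) (at s)"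
      unfolding has_real_derivative_iff_has_vector_derivative[symmetric]
      by (auto intro!: derivative_eq_intros simp: g_def real_sqrt_divide divide_simps)
  qed (use \<sigma> in \<open>auto intro!: continuous_intros\<close>)
  have "(g has_integral (4 * \<sigma> + 4 * \<sigma>)) {b - \<sigma>..b + \<sigma>}"
    by (rule has_integral_combine[where c = b]) (use \<sigma> left right in \<open>simp_all add: mult.assoc\<close>)
  then have "(\<integral>\<^sup>+t. ennreal (g t) * indicator {b - \<sigma>..b + \<sigma>} t \<partial>lborel) = ennreal (4 * \<sigma> + 4 * \<sigma>)"
    using \<sigma> by (intro nn_integral_has_integral_lebesgue') (unfold g_def, auto)
  moreover have "(\<integral>\<^sup>+t. ennreal (u t) * indicator {x..y} t \<partial>lborel) \<le>
      (\<integral>\<^sup>+t. ennreal (g t) * indicator {b - \<sigma>..b + \<sigma>} t \<partial>lborel)"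
  proof (intro nn_integral_mono_AE)
    \<comment> \<open>At \<open>b\<close> division by zero gives the majorant the value 0, and the
      comparison may fail there.\<close>
    have "AE t in lborel. t \<noteq> b" by (rule AE_lborel_singleton)
    then show "AE t in lborel. ennreal (u t) * indicator {x..y} t \<le> ennreal (g t) * indicator {b - \<sigma>..b + \<sigma>} t"
    proof eventually_elim
      case (elim t)
      have "\<bar>t - b\<bar> \<le> norm (of_real t - w)"
        using abs_Re_le_cmod[of "of_real t - w"] by (simp add: b_def)
      then have le: "\<sigma> / norm (of_real t - w) \<le> \<sigma> / \<bar>t - b\<bar>"
        using elim \<sigma> by (intro divide_left_mono mult_pos_pos) auto
      show ?case
      proof (cases "t \<in> {b - \<sigma>..b + \<sigma>}")
        case True
        then have q: "\<sigma> / \<bar>t - b\<bar> \<ge> 1" using elim by (auto simp: divide_simps)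
        have "u t \<le> ln (\<sigma> / \<bar>t - b\<bar>)"
          unfolding u_def using le q by (intro ln_mono) auto
        also have "\<dots> = 2 * ln (sqrt (\<sigma> / \<bar>t - b\<bar>))" using q ln_sqrt[of "\<sigma> / \<bar>t - b\<bar>"] by linarith
        also have "\<dots> \<le> g t"
          using ln_le_minus_one[of "sqrt (\<sigma> / \<bar>t - b\<bar>)"] q by (simp add: g_def)
        finally show ?thesis using True by (auto simp: indicator_def ennreal_leI)
      next
        case False
        then have "\<sigma> / \<bar>t - b\<bar> \<le> 1" using \<sigma> by (auto simp: divide_simps)
        then have "max 1 (\<sigma> / norm (of_real t - w)) = 1" using le by (intro max_absorb1) linarith
        then have "u t = 0" by (simp add: u_def)
        then show ?thesis by simp
      qed
    qed
  qed
  ultimately have I: "(\<integral>\<^sup>+t. ennreal (u t) * indicator {x..y} t \<partial>lborel) \<le> ennreal (8 * \<sigma>)"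
    by simp
  have "u \<in> borel_measurable borel" unfolding u_def by measurable
  moreover have "u t \<ge> 0" for t by (simp add: u_def)
  ultimately show "set_integrable lebesgue E u" "(LINT t:E|lebesgue. u t) \<le> 8 * \<sigma>"
    using set_integral_le_nn_integral[OF _ _ I _ E] \<sigma> by auto
qed

section \<open>Zeros of exponential sums\<close>

lemma expsum_translate:
  "expsum S c v = exp (\<alpha> * v) * expsum ((\<lambda>\<beta>. \<beta> - \<alpha>) ` S) (\<lambda>\<beta>. c (\<beta> + \<alpha>)) v"
proof -
  have eq: "expsum ((\<lambda>\<beta>. \<beta> - \<alpha>) ` S) (\<lambda>\<beta>. c (\<beta> + \<alpha>)) v = (\<Sum>\<beta>\<in>S. c \<beta> * exp ((\<beta> - \<alpha>) * v))"
    unfolding expsum_def by (subst sum.reindex) (auto simp: inj_on_def)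
  have "expsum S c v = (\<Sum>\<beta>\<in>S. exp (\<alpha> * v) * (c \<beta> * exp ((\<beta> - \<alpha>) * v)))"
    unfolding expsum_def by (simp add: left_diff_distrib exp_diff)
  then show ?thesis by (simp only: eq sum_distrib_left)
qed

text \<open>Multiplication by \<open>exp (- \<alpha> * z)\<close> moves the exponents into a disc
  about 0, so that only their distance from \<alpha> matters, not their size.\<close>

lemma expsum_growth_centered:
  assumes S: "finite S" "S \<subseteq> cball \<alpha> d" "S \<noteq> {}"
    and \<sigma>: "0 < \<sigma>" "\<sigma> \<le> \<rho>" and w: "w \<in> cball t \<rho>"
    and M: "\<And>z. z \<in> cball t \<sigma> \<Longrightarrow> norm (exp (- \<alpha> * z) * expsum S c z) \<le> M"
  shows "norm (exp (- \<alpha> * w) * expsum S c w) \<le>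
    real (card S) * (\<rho> / \<sigma>) ^ (card S - 1) * exp (2 * d * \<rho>) * M"
proof -
  let ?S = "(\<lambda>\<beta>. \<beta> - \<alpha>) ` S"
  have eq: "exp (- \<alpha> * z) * expsum S c z = expsum ?S (\<lambda>\<beta>. c (\<beta> + \<alpha>)) z" for z
    by (subst expsum_translate[of S c z \<alpha>]) (simp add: exp_minus)
  have card: "card ?S = card S" by (intro card_image) (auto simp: inj_on_def)
  have "?S \<subseteq> cball 0 d" using S(2) by (auto simp: dist_norm norm_minus_commute)
  from expsum_growth[OF _ this _ \<sigma> w, of "\<lambda>\<beta>. c (\<beta> + \<alpha>)" M] show ?thesis
    using S M unfolding eq card by simp
qed

lemma le_exp_nat: "n \<ge> 1 \<Longrightarrow> real n \<le> exp (real (n - 1))"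
  using exp_ge_add_one_self[of "real (n - 1)"] by (simp add: of_nat_diff)

text \<open>The conclusions of \<open>controlled_factorization\<close> for an entire function. Where
  the zeros lie is not recorded: the logarithmic integrals are bounded for any position of the
  poles.\<close>

definition controlled_factors ::
  "(complex \<Rightarrow> complex) \<Rightarrow> complex \<Rightarrow> real \<Rightarrow> real \<Rightarrow> nat \<Rightarrow> (nat \<Rightarrow> complex) \<Rightarrow> (complex \<Rightarrow> complex) \<Rightarrow> bool"
  where "controlled_factors f x r B N z h \<longleftrightarrow>
    real N \<le> 4 * B \<and> h holomorphic_on UNIV \<and> (\<forall>v. f v = (\<Prod>k<N. v - z k) * h v) \<and>
    (\<forall>v\<in>cball x r. h v \<noteq> 0) \<and>
    (\<forall>u\<in>cball x r. \<forall>v\<in>cball x r. norm (h u) \<le> norm (h v) * exp (exp 4 * (B + 1))) \<and>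
    (\<forall>v\<in>cball x r. norm (deriv h v / h v) \<le> 2 * exp 4 * (B + 1) / r)"

text \<open>The reference point is a maximum point on the disc of radius \<open>r\<close>, and
  \<open>exp B\<close> bounds the growth from there to radius \<open>6 * r\<close>. The parts of
  \<open>B\<close> come from \<open>card S \<le> exp (card S - 1)\<close>,
  \<open>6 \<le> exp 2\<close> and the factor \<open>exp (2 * d * (6 * r))\<close>.\<close>

lemma expsum_factorization:
  assumes S: "finite S" "S \<subseteq> cball \<alpha> d" "S \<noteq> {}" and nz: "expsum S c z0 \<noteq> 0" and r: "r > 0"
  defines "B \<equiv> 3 * real (card S - 1) + 12 * d * r"
  obtains N z h where "controlled_factors (\<lambda>v. exp (- \<alpha> * v) * expsum S c v) x r B N z h"
proof -
  define f where "f v = exp (- \<alpha> * v) * expsum S c v" for v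
  have hol: "f holomorphic_on UNIV" unfolding f_def by (intro holomorphic_intros)
  have "continuous_on (cball x r) (\<lambda>v. norm (f v))"
    using hol holomorphic_on_imp_continuous_on continuous_on_subset continuous_on_norm by blast
  then obtain w where w: "w \<in> cball x r" and max: "\<And>v. v \<in> cball x r \<Longrightarrow> norm (f v) \<le> norm (f w)"
    using continuous_attains_sup[OF compact_cball, of x r "\<lambda>v. norm (f v)"] r by force
  have growth: "norm (f v) \<le> real (card S) * (\<rho> / r) ^ (card S - 1) * exp (2 * d * \<rho>) * norm (f w)"
    if "v \<in> cball x \<rho>" "\<rho> \<ge> r" for v \<rho>
    unfolding f_def by (rule expsum_growth_centered[OF S r that(2,1)]) (use max in \<open>auto simp: f_def\<close>)
  \<comment> \<open>If \<open>f\<close> vanished on the disc of radius \<open>r\<close>, the growth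
    bound on a larger disc would make it vanish at \<open>z0\<close> too.\<close>
  have fw: "norm (f w) > 0"
  proof (rule ccontr)
    assume "\<not> ?thesis"
    then have "f z0 = 0" using growth[of z0 "max r (dist x z0)"] by simp
    then show False using nz by (simp add: f_def)
  qed
  have card: "card S \<ge> 1" using S by (simp add: Suc_le_eq card_gt_0_iff)
  have const: "real (card S) * 6 ^ (card S - 1) * exp (2 * d * (6 * r)) \<le> exp B"
  proof -
    have "(6::real) \<le> exp 1 ^ 2"
      using exp_lower_Taylor_quadratic[of 1] power_mono[of "5/2" "exp 1 :: real" 2]
      by (simp add: power2_eq_square)
    then have "(6::real) \<le> exp 2" by (simp add: exp_of_nat_mult[symmetric])
    then have "(6::real) ^ (card S - 1) \<le> exp 2 ^ (card S - 1)" by (intro power_mono) auto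
    then have "real (card S) * 6 ^ (card S - 1) \<le> exp (real (card S - 1)) * exp 2 ^ (card S - 1)"
      using le_exp_nat[OF card] by (intro mult_mono) auto
    also have "\<dots> = exp (3 * real (card S - 1))"
      by (simp add: exp_of_nat_mult[symmetric] exp_add[symmetric] algebra_simps)
    finally show ?thesis
      unfolding B_def exp_add by (intro mult_mono) auto
  qed
  have "norm (f v) \<le> exp B * norm (f w)" if "v \<in> cball x (6 * r)" for v
  proof -
    have "norm (f v) \<le> real (card S) * 6 ^ (card S - 1) * exp (2 * d * (6 * r)) * norm (f w)"
      using growth[OF that] r by simp
    also have "\<dots> \<le> exp B * norm (f w)" using const by (rule mult_right_mono) auto
    finally show ?thesis .
  qed
  moreover have "norm (f w) \<ge> exp B * norm (f w) * exp (- B)" by (simp add: exp_minus field_simps)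
  ultimately show thesis
  proof (rule controlled_factorization[OF open_UNIV subset_UNIV hol r _ w])
    fix N z h
    assume *: "real N \<le> 4 * B" "h holomorphic_on UNIV"
      "\<And>v. v \<in> UNIV \<Longrightarrow> f v = (\<Prod>k<N. v - z k) * h v"
      "\<And>v. v \<in> cball x r \<Longrightarrow> h v \<noteq> 0"
      "\<And>u v. u \<in> cball x r \<Longrightarrow> v \<in> cball x r \<Longrightarrow> norm (h u) \<le> norm (h v) * exp (exp 4 * (B + 1))"
      "\<And>v. v \<in> cball x r \<Longrightarrow> norm (deriv h v / h v) \<le> 2 * exp 4 * (B + 1) / r"
    then have "controlled_factors f x r B N z h" unfolding controlled_factors_def by auto
    then show thesis unfolding f_def by (rule that)
  qed (use fw in auto)
qed

section \<open>Integrability of the logarithm of an exponential sum\<close>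

lemma real_zeros_finite:
  fixes z :: "nat \<Rightarrow> complex"
  shows "finite {t::real. \<exists>k<N. of_real t = z k}"
proof -
  have "{t::real. \<exists>k<N. of_real t = z k} = of_real -` (z ` {..<N})" by auto
  then show ?thesis by (simp add: finite_vimageI inj_of_real)
qed

lemma AE_lebesgue_not_in_finite: "finite A \<Longrightarrow> AE t in lebesgue. (t::real) \<notin> A"
  by (rule AE_completion) (intro AE_not_in finite_imp_null_set_lborel)

text \<open>On a disc containing the interval the sum is a finite product of factors
  \<open>t - z k\<close> times a zero-free function. The logarithm of each factor splits into a
  continuous positive part and a negative part that is integrable by
  \<open>log_distance_integral\<close> with radius 1.\<close>

lemma ln_norm_expsum_integrable:
  fixes a b :: real
  assumes S: "finite S" "S \<noteq> {}" and nz: "expsum S c z0 \<noteq> 0"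
    and E: "E \<subseteq> {a..b}" "E \<in> sets lebesgue"
  shows "set_integrable lebesgue E (\<lambda>t. ln (norm (expsum S c (of_real t))))"
    and "AE t\<in>E in lebesgue. expsum S c (of_real t) \<noteq> 0"
proof -
  define r where "r = \<bar>b - a\<bar> + 1"
  have r: "r > 0" by (simp add: r_def)
  have sub: "S \<subseteq> cball 0 (Max (norm ` S))" using S by auto
  obtain N z h where "controlled_factors (\<lambda>v. exp (- 0 * v) * expsum S c v) (of_real a) r
      (3 * real (card S - 1) + 12 * Max (norm ` S) * r) N z h"
    by (rule expsum_factorization[OF S(1) sub S(2) nz r])
  then have h: "h holomorphic_on UNIV"
    "\<forall>v. expsum S c v = (\<Prod>k<N. v - z k) * h v"
    "\<forall>v\<in>cball (of_real a) r. h v \<noteq> 0"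
    unfolding controlled_factors_def by auto
  have hnz: "h (of_real t) \<noteq> 0" if "t \<in> {a..b}" for t
    using that by (intro h(3)[rule_format]) (auto simp: r_def dist_of_real dist_real_def)
  define Z where "Z = {t::real. \<exists>k<N. of_real t = z k}"
  have Z: "finite Z" unfolding Z_def by (rule real_zeros_finite)
  have nonzero: "expsum S c (of_real t) \<noteq> 0" if "t \<in> E - Z" for t
    using that h(2) hnz E by (auto simp: Z_def)
  show "AE t\<in>E in lebesgue. expsum S c (of_real t) \<noteq> 0"
    using AE_lebesgue_not_in_finite[OF Z] by eventually_elim (use nonzero in auto)
  have cont_int: "set_integrable lebesgue E g" if "continuous_on {a..b} g" for g :: "real \<Rightarrow> real"
    by (rule set_integrable_subset[OF absolutely_integrable_continuous_real[OF that] E(2,1)])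
  have conth: "continuous_on UNIV h" using h(1) by (rule holomorphic_on_imp_continuous_on)
  have int_h: "set_integrable lebesgue E (\<lambda>t. ln (norm (h (of_real t))))"
    using hnz by (intro cont_int continuous_intros continuous_on_compose2[OF conth]) auto
  have int_z: "set_integrable lebesgue E
      (\<lambda>t. ln (max 1 (norm (of_real t - w))) - ln (max 1 (1 / norm (of_real t - w))))" for w :: complex
    by (rule set_integral_diff(1)[OF cont_int log_distance_integral(1)[OF zero_less_one E]])
      (intro continuous_intros, auto)
  have int: "set_integrable lebesgue E (\<lambda>t. (\<Sum>k<N. ln (max 1 (norm (of_real t - z k))) -
      ln (max 1 (1 / norm (of_real t - z k)))) + ln (norm (h (of_real t))))"
    by (rule set_integral_add(1)[OF absolutely_integrable_sum[OF finite_lessThan int_z] int_h])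
  show "set_integrable lebesgue E (\<lambda>t. ln (norm (expsum S c (of_real t))))"
  proof (rule absolutely_integrable_spike[OF int])
    show "negligible Z" using Z by (rule negligible_finite)
    fix t assume t: "t \<in> E - Z"
    have pos: "norm (of_real t - z k) > 0" if "k < N" for k
      using t that by (auto simp: Z_def)
    have "ln (norm (of_real t - z k)) = ln (max 1 (norm (of_real t - z k))) -
      ln (max 1 (1 / norm (of_real t - z k)))" if "k < N" for k
      using pos[OF that] by (auto simp: max_def ln_div divide_simps)
    then have "(\<Sum>k<N. ln (max 1 (norm (of_real t - z k))) - ln (max 1 (1 / norm (of_real t - z k)))) =
      ln (\<Prod>k<N. norm (of_real t - z k))"
      using pos by (subst ln_prod) auto
    also have "\<dots> + ln (norm (h (of_real t))) = ln ((\<Prod>k<N. norm (of_real t - z k)) * norm (h (of_real t)))"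
    proof (rule ln_mult_pos[symmetric])
      show "(\<Prod>k<N. norm (of_real t - z k)) > 0" using pos by (intro prod_pos) auto
    qed (use t E hnz in auto)
    finally show "ln (norm (expsum S c (of_real t))) =
      (\<Sum>k<N. ln (max 1 (norm (of_real t - z k))) - ln (max 1 (1 / norm (of_real t - z k)))) +
      ln (norm (h (of_real t)))"
      using h(2) by (simp add: norm_mult prod_norm)
  qed
qed

section \<open>The Turan--Nazarov inequality\<close>

lemma has_field_derivative_prod_diff:
  fixes z :: "nat \<Rightarrow> 'a::real_normed_field"
  assumes "\<And>k. k < N \<Longrightarrow> t \<noteq> z k"
  shows "((\<lambda>v. \<Prod>k<N. v - z k) has_field_derivative (\<Prod>k<N. t - z k) * (\<Sum>k<N. 1 / (t - z k))) (at t)"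
  using assms
proof (induction N)
  case (Suc N)
  have "((\<lambda>v. (\<Prod>k<N. v - z k) * (v - z N)) has_field_derivative
      (\<Prod>k<N. t - z k) * (\<Sum>k<N. 1 / (t - z k)) * (t - z N) + 1 * (\<Prod>k<N. t - z k)) (at t)"
    using Suc by (intro DERIV_mult Suc.IH) (auto intro!: derivative_eq_intros)
  moreover have "(\<Prod>k<N. t - z k) * (\<Sum>k<N. 1 / (t - z k)) * (t - z N) + 1 * (\<Prod>k<N. t - z k) =
      (\<Prod>k<Suc N. t - z k) * (\<Sum>k<Suc N. 1 / (t - z k))"
    using Suc.prems[of N] by (simp add: field_simps)
  ultimately show ?case by simp
qed simp

lemma expsum_diff_deriv:
  assumes "finite S"
  shows "expsum S (\<lambda>\<beta>. \<beta> * c \<beta>) v - \<alpha> * expsum S c v = expsum (S - {\<alpha>}) (\<lambda>\<beta>. (\<beta> - \<alpha>) * c \<beta>) v"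
proof -
  have "expsum S (\<lambda>\<beta>. \<beta> * c \<beta>) v - \<alpha> * expsum S c v = expsum S (\<lambda>\<beta>. (\<beta> - \<alpha>) * c \<beta>) v"
    by (simp add: expsum_def sum_subtractf sum_distrib_left algebra_simps)
  also have "\<dots> = expsum (S - {\<alpha>}) (\<lambda>\<beta>. (\<beta> - \<alpha>) * c \<beta>) v"
    unfolding expsum_def using assms by (intro sum.mono_neutral_right) auto
  finally show ?thesis .
qed

text \<open>Logarithmic differentiation of \<open>exp (- \<alpha> * v) * expsum S c v\<close>, whose
  derivative is \<open>exp (- \<alpha> * v)\<close> times the sum with the exponent \<alpha>
  eliminated. This expresses the elimination by a Cauchy sum over the zeros.\<close>

lemma expsum_log_deriv:
  fixes z :: "nat \<Rightarrow> complex"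
  assumes S: "finite S" and h: "h holomorphic_on UNIV"
    and eq: "\<And>v. exp (- \<alpha> * v) * expsum S c v = (\<Prod>k<N. v - z k) * h v"
    and t: "\<And>k. k < N \<Longrightarrow> t \<noteq> z k" "h t \<noteq> 0"
  shows "expsum (S - {\<alpha>}) (\<lambda>\<beta>. (\<beta> - \<alpha>) * c \<beta>) t =
    expsum S c t * ((\<Sum>k<N. 1 / (t - z k)) + deriv h t / h t)"
proof -
  have 1: "((\<lambda>v. exp (- \<alpha> * v) * expsum S c v) has_field_derivative
     exp (- \<alpha> * t) * (expsum S (\<lambda>\<beta>. \<beta> * c \<beta>) t - \<alpha> * expsum S c t)) (at t)"
    by (rule derivative_eq_intros expsum_deriv refl)+ (simp add: algebra_simps)
  have "(h has_field_derivative deriv h t) (at t)"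
    using h by (auto intro: holomorphic_derivI)
  from DERIV_mult[OF has_field_derivative_prod_diff[of N t z, OF t(1)] this]
  have 2: "((\<lambda>v. exp (- \<alpha> * v) * expsum S c v) has_field_derivative
     (\<Prod>k<N. t - z k) * (\<Sum>k<N. 1 / (t - z k)) * h t + deriv h t * (\<Prod>k<N. t - z k)) (at t)"
    unfolding eq by simp
  have "(\<Prod>k<N. t - z k) * (\<Sum>k<N. 1 / (t - z k)) * h t + deriv h t * (\<Prod>k<N. t - z k) =
     (\<Prod>k<N. t - z k) * h t * ((\<Sum>k<N. 1 / (t - z k)) + deriv h t / h t)"
    using t(2) by (simp add: field_simps)
  also have "\<dots> = exp (- \<alpha> * t) * (expsum S c t * ((\<Sum>k<N. 1 / (t - z k)) + deriv h t / h t))"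
    by (simp only: eq[symmetric] mult.assoc)
  finally have "exp (- \<alpha> * t) * (expsum S (\<lambda>\<beta>. \<beta> * c \<beta>) t - \<alpha> * expsum S c t) =
      exp (- \<alpha> * t) * (expsum S c t * ((\<Sum>k<N. 1 / (t - z k)) + deriv h t / h t))"
    using DERIV_unique[OF 1 2] by simp
  then show ?thesis unfolding expsum_diff_deriv[OF S] by simp
qed

lemma set_integral_const:
  fixes E :: "real set" and C :: real
  assumes "E \<subseteq> {a..b}" "E \<in> sets lebesgue"
  shows "set_integrable lebesgue E (\<lambda>_. C)" "(LINT t:E|lebesgue. C) = measure lebesgue E * C"
proof -
  have "E \<in> lmeasurable"
    using assms bounded_closed_interval bounded_set_imp_lmeasurable bounded_subset by metis
  then have "integrable lebesgue (indicator E :: real \<Rightarrow> real)" "emeasure lebesgue E < \<infinity>"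
    by (auto simp: fmeasurable_def integrable_indicator_iff lmeasurable_iff_integrable)
  then show "set_integrable lebesgue E (\<lambda>_. C)" "(LINT t:E|lebesgue. C) = measure lebesgue E * C"
    unfolding set_integrable_def set_lebesgue_integral_def by (auto simp: mult.commute)
qed

lemma measure_subset_interval:
  fixes E :: "real set"
  assumes "E \<subseteq> {a..b}" "E \<in> sets lebesgue" "measure lebesgue E > 0"
  shows "a < b" "measure lebesgue E \<le> b - a"
proof -
  have "measure lebesgue E \<le> measure lebesgue {a..b}"
    using assms by (intro measure_mono_fmeasurable) auto
  then show "a < b" "measure lebesgue E \<le> b - a" using assms(3) by (auto split: if_splits)
qed

text \<open>The case of large diameter. Eliminating \<alpha> multiplies the sum by a logarithmic
  derivative; its mean logarithm over \<open>E\<close> is estimated by the Cauchy sum bounds. The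
  lower bound on \<open>d * (b - a)\<close> makes the number of zeros at most a multiple of
  \<open>d * (b - a)\<close>.\<close>

lemma elimination_step:
  fixes a b d :: real
  assumes S: "finite S" "card S \<ge> 2" and d: "S \<subseteq> cball \<alpha> d" "real (card S - 1) \<le> d * (b - a)"
    and nzp: "expsum S c z0 \<noteq> 0" and nzq: "expsum (S - {\<alpha>}) (\<lambda>\<beta>. (\<beta> - \<alpha>) * c \<beta>) z1 \<noteq> 0"
    and E: "E \<subseteq> {a..b}" "E \<in> sets lebesgue" "measure lebesgue E > 0"
  shows "(LINT t:E|lebesgue. ln (norm (expsum (S - {\<alpha>}) (\<lambda>\<beta>. (\<beta> - \<alpha>) * c \<beta>) (of_real t)))) \<le>
    measure lebesgue E * (ln (128 * exp 4 * d * (b - a) / measure lebesgue E) + 32) +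
    (LINT t:E|lebesgue. ln (norm (expsum S c (of_real t))))"
proof -
  define \<sigma> where "\<sigma> = measure lebesgue E"
  define l where "l = b - a"
  define q where "q t = expsum (S - {\<alpha>}) (\<lambda>\<beta>. (\<beta> - \<alpha>) * c \<beta>) (of_real t)" for t :: real
  define p where "p t = expsum S c (of_real t)" for t :: real
  have l: "l > 0" and \<sigma>0: "\<sigma> > 0" "\<sigma> \<le> l" using measure_subset_interval[OF E] E(3) by (auto simp: l_def \<sigma>_def)
  have dl: "real (card S - 1) \<le> d * l" "1 \<le> d * l" using d(2) S(2) by (auto simp: l_def)
  then have "d * l > 0" by linarith
  then have d0: "d > 0" using l by (simp add: zero_less_mult_iff)
  define B where "B = 3 * real (card S - 1) + 12 * d * l"
  have B: "B + 1 \<le> 16 * (d * l)" using dl by (simp add: B_def)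
  have Sne: "S \<noteq> {}" using S by auto
  obtain N z h where "controlled_factors (\<lambda>v. exp (- \<alpha> * v) * expsum S c v) (of_real a) l
      (3 * real (card S - 1) + 12 * d * l) N z h"
    by (rule expsum_factorization[OF S(1) d(1) Sne nzp l])
  then have N: "real N \<le> 4 * B" and h: "h holomorphic_on UNIV"
    and eq: "\<And>v. exp (- \<alpha> * v) * expsum S c v = (\<Prod>k<N. v - z k) * h v"
    and hnz: "\<And>v. v \<in> cball (of_real a) l \<Longrightarrow> h v \<noteq> 0"
    and hderiv: "\<And>v. v \<in> cball (of_real a) l \<Longrightarrow> norm (deriv h v / h v) \<le> 2 * exp 4 * (B + 1) / l"
    unfolding controlled_factors_def B_def by auto
  have t_in: "of_real t \<in> cball (of_real a :: complex) l" if "t \<in> E" for t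
    using E(1) that by (auto simp: l_def dist_of_real dist_real_def)
  \<comment> \<open>This scale makes \<open>s\<close> times the logarithmic derivative of
    \<open>h\<close> at most 1 and \<open>s * N\<close> at most \<open>2 * \<sigma>\<close>.\<close>
  define s where "s = \<sigma> / (32 * exp 4 * d * l)"
  have s: "s > 0" using \<sigma>0 d0 l by (simp add: s_def)
  \<comment> \<open>For real \<open>t\<close>, reflecting a pole conjugates
    \<open>1 / (t - z k)\<close>. The reflected group is summed apart from the other one, since
    conjugating only some terms would change the norm of the total.\<close>
  define w where "w k = (if Im (z k) \<le> 0 then z k else cnj (z k))" for k
  define K1 where "K1 = {k. k < N \<and> Im (z k) \<le> 0}"
  define K2 where "K2 = {k. k < N \<and> Im (z k) > 0}"
  have K: "finite K1" "finite K2" "K1 \<union> K2 = {..<N}" "K1 \<inter> K2 = {}"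
    by (auto simp: K1_def K2_def)
  have card: "real (card K1) + real (card K2) = real N"
    using card_Un_disjoint[OF K(1,2,4)] K(3) by simp
  have w1: "Im (w k) \<le> 0" for k by (simp add: w_def)
  define u1 where "u1 t = ln (norm (1 + \<i> * of_real s * (\<Sum>k\<in>K1. 1 / (of_real t - w k))))" for t :: real
  define u2 where "u2 t = ln (norm (1 + \<i> * of_real s * (\<Sum>k\<in>K2. 1 / (of_real t - w k))))" for t :: real
  have U1: "set_integrable lebesgue E u1" "(LINT t:E|lebesgue. u1 t) \<le> 4 * pi * s * real (card K1)"
    unfolding u1_def by (rule log_cauchy_sum_bounds[OF K(1) w1 s E(1,2)])+
  have U2: "set_integrable lebesgue E u2" "(LINT t:E|lebesgue. u2 t) \<le> 4 * pi * s * real (card K2)"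
    unfolding u2_def by (rule log_cauchy_sum_bounds[OF K(2) w1 s E(1,2)])+
  have U3: "1 + s * norm (\<Sum>k\<in>K1. 1 / (of_real t - w k)) \<le> 2 * exp (u1 t)"
    "1 + s * norm (\<Sum>k\<in>K2. 1 / (of_real t - w k)) \<le> 2 * exp (u2 t)" for t :: real
    unfolding u1_def u2_def
    by (rule log_cauchy_sum_bounds(3)[OF K(1) w1 s E(1,2)] log_cauchy_sum_bounds(3)[OF K(2) w1 s E(1,2)])+
  have sum_split: "norm (\<Sum>k<N. 1 / (of_real t - z k)) \<le>
     norm (\<Sum>k\<in>K1. 1 / (of_real t - w k)) + norm (\<Sum>k\<in>K2. 1 / (of_real t - w k))" for t :: real
  proof -
    have "(\<Sum>k<N. 1 / (of_real t - z k)) =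
       (\<Sum>k\<in>K1. 1 / (of_real t - z k)) + (\<Sum>k\<in>K2. 1 / (of_real t - z k))"
      unfolding K(3)[symmetric] using K by (intro sum.union_disjoint) auto
    also have "(\<Sum>k\<in>K1. 1 / (of_real t - z k)) = (\<Sum>k\<in>K1. 1 / (of_real t - w k))"
      by (intro sum.cong) (auto simp: K1_def w_def)
    also have "(\<Sum>k\<in>K2. 1 / (of_real t - z k)) = cnj (\<Sum>k\<in>K2. 1 / (of_real t - w k))"
      unfolding cnj_sum by (intro sum.cong) (auto simp: K2_def w_def)
    finally show ?thesis using norm_triangle_ineq by (metis complex_mod_cnj)
  qed
  define Z where "Z = {t::real. \<exists>k<N. of_real t = z k}"
  have Z: "finite Z" unfolding Z_def by (rule real_zeros_finite)
  have S1: "S - {\<alpha>} \<noteq> {}"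
  proof
    assume "S - {\<alpha>} = {}"
    then show False using nzq by (simp only: expsum_def sum.empty)
  qed
  note Ip = ln_norm_expsum_integrable[OF S(1) Sne nzp E(1,2), folded p_def]
  note Iq = ln_norm_expsum_integrable[OF finite_Diff[OF S(1)] S1 nzq E(1,2), folded q_def]
  have pointwise: "ln (norm (q t)) \<le> ln (4 / s) + ln (norm (p t)) + (u1 t + u2 t)"
    if t: "t \<in> E" "t \<notin> Z" "p t \<noteq> 0" "q t \<noteq> 0" for t
  proof -
    let ?L = "(\<Sum>k<N. 1 / (of_real t - z k)) + deriv h (of_real t) / h (of_real t)"
    have qp: "q t = p t * ?L"
      unfolding q_def p_def using t(2) hnz[OF t_in[OF t(1)]]
      by (intro expsum_log_deriv[OF S(1) h eq]) (auto simp: Z_def)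
    let ?A = "norm (\<Sum>k\<in>K1. 1 / (of_real t - w k))" and ?B = "norm (\<Sum>k\<in>K2. 1 / (of_real t - w k))"
    have "norm (deriv h (of_real t) / h (of_real t)) \<le> 2 * exp 4 * (B + 1) / l"
      by (rule hderiv[OF t_in[OF t(1)]])
    also have "\<dots> \<le> 2 * exp 4 * (16 * (d * l)) / l"
      using B l by (intro divide_right_mono mult_left_mono) auto
    also have "\<dots> = 32 * exp 4 * d" using l by simp
    finally have "s * norm (deriv h (of_real t) / h (of_real t)) \<le> s * (32 * exp 4 * d)"
      using s by (intro mult_left_mono) auto
    also have "\<dots> = \<sigma> / l" using d0 l by (simp add: s_def)
    also have "\<dots> \<le> 1" using \<sigma>0 l by simp
    finally have hd: "s * norm (deriv h (of_real t) / h (of_real t)) \<le> 1" .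
    have "s * norm ?L \<le> s * (?A + ?B + norm (deriv h (of_real t) / h (of_real t)))"
      using s sum_split[of t] norm_triangle_ineq[of "\<Sum>k<N. 1 / (of_real t - z k)" "deriv h (of_real t) / h (of_real t)"]
      by (intro mult_left_mono) linarith+
    also have "\<dots> \<le> 1 + s * ?A + s * ?B" using hd by (simp add: distrib_left)
    \<comment> \<open>The product form lets the two groups of poles contribute additively after
      taking logarithms.\<close>
    also have "\<dots> \<le> (1 + s * ?A) * (1 + s * ?B)"
      using s by (simp add: distrib_left distrib_right)
    also have "\<dots> \<le> (2 * exp (u1 t)) * (2 * exp (u2 t))"
      using s by (intro mult_mono U3) auto
    finally have "norm ?L \<le> 4 / s * exp (u1 t + u2 t)"
      using s by (simp add: exp_add field_simps)
    then have "norm (q t) \<le> norm (p t) * (4 / s * exp (u1 t + u2 t))"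
      unfolding qp norm_mult by (rule mult_left_mono) simp
    then have "ln (norm (q t)) \<le> ln (norm (p t) * (4 / s * exp (u1 t + u2 t)))"
      using t(4) by (intro ln_mono) auto
    also have "\<dots> = ln (4 / s) + ln (norm (p t)) + (u1 t + u2 t)"
      using t(3) s by (simp add: ln_mult ln_div)
    finally show ?thesis .
  qed
  have AE: "AE t\<in>E in lebesgue. ln (norm (q t)) \<le> ln (4 / s) + ln (norm (p t)) + (u1 t + u2 t)"
    using Ip(2) Iq(2) AE_lebesgue_not_in_finite[OF Z] by eventually_elim (use pointwise in auto)
  note C = set_integral_const[OF E(1,2), of "ln (4 / s)"]
  have I3: "set_integrable lebesgue E (\<lambda>t. ln (4 / s) + ln (norm (p t)) + (u1 t + u2 t))"
    by (intro set_integral_add(1) C Ip U1 U2)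
  have "(LINT t:E|lebesgue. ln (norm (q t))) \<le> (LINT t:E|lebesgue. ln (4 / s) + ln (norm (p t)) + (u1 t + u2 t))"
    by (rule set_integral_mono_AE[OF Iq(1) I3 AE])
  also have "\<dots> = \<sigma> * ln (4 / s) + (LINT t:E|lebesgue. ln (norm (p t))) +
      ((LINT t:E|lebesgue. u1 t) + (LINT t:E|lebesgue. u2 t))"
    using C Ip(1) U1(1) U2(1) by (simp add: set_integral_add \<sigma>_def)
  also have "(LINT t:E|lebesgue. u1 t) + (LINT t:E|lebesgue. u2 t) \<le>
      4 * pi * s * real (card K1) + 4 * pi * s * real (card K2)"
    by (intro add_mono U1 U2)
  also have "\<dots> = 4 * pi * (s * real N)"
    unfolding card[symmetric] by (simp add: algebra_simps)
  \<comment> \<open>With \<open>pi < 4\<close> this is the origin of the summand 32 in the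
    conclusion.\<close>
  also have "\<dots> \<le> 16 * (2 * \<sigma>)"
  proof (rule mult_mono)
    have "s * real N \<le> s * (64 * (d * l))" using s N B by (intro mult_left_mono) auto
    also have "\<dots> = 2 * \<sigma> / exp 4" using d0 l by (simp add: s_def)
    also have "\<dots> \<le> 2 * \<sigma>" using \<sigma>0 by (simp add: divide_simps)
    finally show "s * real N \<le> 2 * \<sigma>" .
  qed (use pi_less_4 s in auto)
  finally have "(LINT t:E|lebesgue. ln (norm (q t))) \<le>
      \<sigma> * (ln (4 / s) + 32) + (LINT t:E|lebesgue. ln (norm (p t)))"
    by (simp add: distrib_left)
  moreover have "4 / s = 128 * exp 4 * d * l / \<sigma>" using \<sigma>0 d0 l by (simp add: s_def)
  ultimately show ?thesis by (simp only: q_def p_def \<sigma>_def l_def)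
qed

text \<open>A direct bound, without induction. For almost every \<open>t\<close> in
  \<open>E\<close>, the sum on the disc about \<open>t\<close> of radius
  \<open>measure lebesgue E\<close> is bounded by its value at \<open>t\<close>, up to factors for
  the nearby zeros; growth from that disc to one containing \<open>y\<close> gives the power
  \<open>card S - 1\<close>. The logarithm is then averaged over \<open>t\<close>.\<close>

lemma small_diameter:
  fixes a b d :: real
  assumes S: "finite S" "card S \<ge> 2" and d: "S \<subseteq> cball \<alpha> d" "d * (b - a) \<le> real (card S - 1)" "d \<ge> 0"
    and nzp: "expsum S c z0 \<noteq> 0"
    and E: "E \<subseteq> {a..b}" "E \<in> sets lebesgue" "measure lebesgue E > 0"
    and y: "y \<in> {a..b}" and py: "expsum S c (of_real y) \<noteq> 0"
  shows "ln (norm (expsum S c (of_real y))) \<le> (b - a) * \<bar>Re \<alpha>\<bar> +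
    real (card S - 1) * (ln ((b - a) / measure lebesgue E) + (975 + 28 * exp 4)) +
    (LINT t:E|lebesgue. ln (norm (expsum S c (of_real t)))) / measure lebesgue E"
proof -
  define \<sigma> where "\<sigma> = measure lebesgue E"
  define l where "l = b - a"
  define n where "n = real (card S - 1)"
  define p where "p t = expsum S c (of_real t)" for t :: real
  have l: "l > 0" and \<sigma>0: "\<sigma> > 0" "\<sigma> \<le> l" using measure_subset_interval[OF E] E(3) by (auto simp: l_def \<sigma>_def)
  have dl: "d * l \<le> n" "1 \<le> n" using d(2) S(2) by (auto simp: l_def n_def)
  \<comment> \<open>The factorization uses radius \<open>2 * l\<close>, so that discs of radius
    \<open>\<sigma> \<le> l\<close> about points of the interval stay inside.\<close>
  have l2: "2 * l > 0" using l by simp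
  define B where "B = 3 * n + 12 * d * (2 * l)"
  have B: "B \<le> 27 * n" using dl by (simp add: B_def)
  have Sne: "S \<noteq> {}" using S by auto
  obtain N z h where "controlled_factors (\<lambda>v. exp (- \<alpha> * v) * expsum S c v) (of_real a) (2 * l)
      (3 * real (card S - 1) + 12 * d * (2 * l)) N z h"
    by (rule expsum_factorization[OF S(1) d(1) Sne nzp l2])
  then have N: "real N \<le> 4 * B"
    and eq: "\<And>v. exp (- \<alpha> * v) * expsum S c v = (\<Prod>k<N. v - z k) * h v"
    and ratio: "\<And>u v. u \<in> cball (of_real a) (2 * l) \<Longrightarrow> v \<in> cball (of_real a) (2 * l) \<Longrightarrow>
      norm (h u) \<le> norm (h v) * exp (exp 4 * (B + 1))"
    unfolding controlled_factors_def B_def n_def by auto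
  have N': "real N \<le> 108 * n" using N B by simp
  have Q: "exp 4 * (B + 1) \<le> 28 * exp 4 * n" using B dl by simp
  define u where "u k t = ln (max 1 (\<sigma> / norm (of_real t - z k)))" for k and t :: real
  note U = log_distance_integral[OF \<sigma>0(1) E(1,2), of "z _", folded u_def]
  define Z where "Z = {t::real. \<exists>k<N. of_real t = z k}"
  have Z: "finite Z" unfolding Z_def by (rule real_zeros_finite)
  note Ip = ln_norm_expsum_integrable[OF S(1) Sne nzp E(1,2), folded p_def]
  \<comment> \<open>Here 111 = 1 + 2 + 108, from \<open>card S\<close>, from the growth factor
    \<open>exp (2 * d * l)\<close> and from \<open>2 ^ N\<close>; the term \<open>28 * exp 4\<close>
    is the oscillation of \<open>h\<close>.\<close>
  have pointwise: "ln (norm (p y)) \<le> l * \<bar>Re \<alpha>\<bar> + n * (ln (l / \<sigma>) + (111 + 28 * exp 4)) +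
      ln (norm (p t)) + (\<Sum>k<N. u k t)"
    if t: "t \<in> E" "t \<notin> Z" "p t \<noteq> 0" for t
  proof -
    have tab: "t \<in> {a..b}" using t E by auto
    have tz: "norm (of_real t - z k) > 0" if "k < N" for k using t that by (auto simp: Z_def)
    define P where "P = (\<Prod>k<N. exp (u k t))"
    have expu: "exp (u k t) = max 1 (\<sigma> / norm (of_real t - z k))" for k
      by (simp add: u_def exp_ln max.strict_coboundedI1)
    have t_in: "v \<in> cball (of_real a) (2 * l)" if "v \<in> cball (of_real t) \<sigma>" for v :: complex
    proof -
      have "dist (of_real a) v \<le> dist (of_real a) (of_real t :: complex) + dist (of_real t) v"
        by (rule dist_triangle)
      then show ?thesis using that tab \<sigma>0 by (simp add: dist_of_real dist_real_def l_def)
    qed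
    define M where "M = norm (exp (- \<alpha> * of_real t) * expsum S c (of_real t)) * (2 ^ N * P * exp (28 * exp 4 * n))"
    have bound: "norm (exp (- \<alpha> * v) * expsum S c v) \<le> M" if v: "v \<in> cball (of_real t) \<sigma>" for v
    proof -
      have "(\<Prod>k<N. norm (v - z k)) \<le> (\<Prod>k<N. norm (of_real t - z k) * (2 * exp (u k t)))"
      proof (intro prod_mono conjI)
        fix k assume k: "k \<in> {..<N}"
        have "norm (v - z k) \<le> norm (v - of_real t) + norm (of_real t - z k)"
          by (metis diff_add_cancel add_diff_eq norm_triangle_ineq)
        also have "norm (v - of_real t) \<le> \<sigma>" using v by (simp add: dist_norm norm_minus_commute)
        also have "\<sigma> + norm (of_real t - z k) \<le> norm (of_real t - z k) * (2 * max 1 (\<sigma> / norm (of_real t - z k)))"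
          using tz[of k] k by (auto simp: max_def field_simps)
        finally show "norm (v - z k) \<le> norm (of_real t - z k) * (2 * exp (u k t))" by (simp add: expu)
      qed auto
      also have "\<dots> = (\<Prod>k<N. norm (of_real t - z k)) * (2 ^ N * P)"
        by (simp add: prod.distrib P_def)
      finally have 1: "(\<Prod>k<N. norm (v - z k)) \<le> (\<Prod>k<N. norm (of_real t - z k)) * (2 ^ N * P)" .
      have "norm (h v) \<le> norm (h (of_real t)) * exp (exp 4 * (B + 1))"
        using t_in[OF v] t_in[of "of_real t"] \<sigma>0 by (intro ratio) auto
      also have "\<dots> \<le> norm (h (of_real t)) * exp (28 * exp 4 * n)"
        using Q by (intro mult_left_mono) auto
      finally have 2: "norm (h v) \<le> norm (h (of_real t)) * exp (28 * exp 4 * n)" .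
      have "norm (exp (- \<alpha> * v) * expsum S c v) = (\<Prod>k<N. norm (v - z k)) * norm (h v)"
        unfolding eq norm_mult prod_norm ..
      also have "\<dots> \<le> ((\<Prod>k<N. norm (of_real t - z k)) * (2 ^ N * P)) * (norm (h (of_real t)) * exp (28 * exp 4 * n))"
        by (intro mult_mono 1 2) (auto simp: P_def intro!: prod_nonneg mult_nonneg_nonneg)
      also have "\<dots> = M" unfolding M_def eq norm_mult prod_norm by simp
      finally show ?thesis .
    qed
    have yt: "of_real y \<in> cball (of_real t :: complex) l"
      using y tab by (auto simp: dist_of_real dist_real_def l_def)
    have card: "card S \<ge> 1" using S by simp
    have "norm (exp (- \<alpha> * of_real y) * expsum S c (of_real y)) \<le>
        real (card S) * (l / \<sigma>) ^ (card S - 1) * exp (2 * d * l) * M"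
      by (rule expsum_growth_centered[OF S(1) d(1) Sne \<sigma>0 yt bound])
    also have "\<dots> \<le> exp n * exp (n * ln (l / \<sigma>)) * exp (2 * n) * M"
    proof (intro mult_right_mono mult_mono)
      show "real (card S) \<le> exp n" unfolding n_def using card by (rule le_exp_nat)
      show "(l / \<sigma>) ^ (card S - 1) \<le> exp (n * ln (l / \<sigma>))"
        using l \<sigma>0 unfolding n_def by (simp add: exp_of_nat_mult)
      show "M \<ge> 0" by (auto simp: M_def P_def intro!: mult_nonneg_nonneg prod_nonneg)
    qed (use dl l \<sigma>0 in auto)
    also have "M \<le> norm (exp (- \<alpha> * of_real t) * expsum S c (of_real t)) *
        (exp (108 * n) * exp (\<Sum>k<N. u k t) * exp (28 * exp 4 * n))"
      unfolding M_def
    proof (intro mult_left_mono mult_right_mono mult_mono)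
      have "(2::real) ^ N \<le> exp 1 ^ N" using exp_ge_add_one_self[of 1] by (intro power_mono) auto
      also have "\<dots> = exp (real N)" by (simp add: exp_of_nat_mult[symmetric])
      also have "\<dots> \<le> exp (108 * n)" using N' by simp
      finally show "(2::real) ^ N \<le> exp (108 * n)" .
      show "P \<le> exp (\<Sum>k<N. u k t)" by (simp add: P_def exp_sum)
      show "P \<ge> 0" by (auto simp: P_def intro!: prod_nonneg)
    qed auto
    also have "exp n * exp (n * ln (l / \<sigma>)) * exp (2 * n) *
        (X * (exp (108 * n) * exp (\<Sum>k<N. u k t) * exp (28 * exp 4 * n))) =
        X * exp (n * (ln (l / \<sigma>) + (111 + 28 * exp 4)) + (\<Sum>k<N. u k t))" for X :: real
    proof -
      have "n * (ln (l / \<sigma>) + (111 + 28 * exp 4)) + (\<Sum>k<N. u k t) =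
          n + n * ln (l / \<sigma>) + 2 * n + (108 * n + (\<Sum>k<N. u k t) + 28 * exp 4 * n)"
        by (simp add: algebra_simps)
      then show ?thesis by (simp only: exp_add mult_ac)
    qed
    finally have 3: "norm (exp (- \<alpha> * of_real y) * p y) \<le> norm (exp (- \<alpha> * of_real t) * p t) *
        exp (n * (ln (l / \<sigma>) + (111 + 28 * exp 4)) + (\<Sum>k<N. u k t))"
      unfolding p_def by simp
    have nexp: "norm (exp (- \<alpha> * of_real x) * v) = exp (- (Re \<alpha> * x)) * norm v" for x :: real and v
      unfolding norm_mult norm_exp_eq_Re by simp
    have "norm (p y) = exp (Re \<alpha> * y) * norm (exp (- \<alpha> * of_real y) * p y)"
      unfolding nexp by (simp add: exp_minus)
    also have "\<dots> \<le> exp (Re \<alpha> * y) * (norm (exp (- \<alpha> * of_real t) * p t) *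
        exp (n * (ln (l / \<sigma>) + (111 + 28 * exp 4)) + (\<Sum>k<N. u k t)))"
      using 3 by (rule mult_left_mono) simp
    also have "\<dots> = norm (p t) * exp (Re \<alpha> * (y - t) + (n * (ln (l / \<sigma>) + (111 + 28 * exp 4)) + (\<Sum>k<N. u k t)))"
      unfolding nexp right_diff_distrib exp_add exp_diff by (simp add: exp_minus field_simps)
    finally have "ln (norm (p y)) \<le> ln (norm (p t) *
        exp (Re \<alpha> * (y - t) + (n * (ln (l / \<sigma>) + (111 + 28 * exp 4)) + (\<Sum>k<N. u k t))))"
      using py by (intro ln_mono) (auto simp: p_def)
    also have "\<dots> = ln (norm (p t)) + (Re \<alpha> * (y - t) + (n * (ln (l / \<sigma>) + (111 + 28 * exp 4)) + (\<Sum>k<N. u k t)))"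
      using t(3) by (simp add: ln_mult)
    also have "Re \<alpha> * (y - t) \<le> \<bar>Re \<alpha>\<bar> * l"
    proof -
      have "Re \<alpha> * (y - t) \<le> \<bar>Re \<alpha>\<bar> * \<bar>y - t\<bar>" by (metis abs_ge_self abs_mult)
      also have "\<dots> \<le> \<bar>Re \<alpha>\<bar> * l" using y tab by (intro mult_left_mono) (auto simp: l_def)
      finally show ?thesis .
    qed
    finally show ?thesis by (simp add: mult.commute)
  qed
  \<comment> \<open>\<open>D\<close> collects what does not depend on \<open>t\<close>, so averaging
    over \<open>E\<close> leaves it unchanged. The distance terms add
    \<open>8 * N \<le> 864 * n\<close>, and 975 = 111 + 864.\<close>
  define D where "D = ln (norm (p y)) - l * \<bar>Re \<alpha>\<bar> - n * (ln (l / \<sigma>) + (111 + 28 * exp 4))"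
  have AE: "AE t\<in>E in lebesgue. D \<le> ln (norm (p t)) + (\<Sum>k<N. u k t)"
    using Ip(2) AE_lebesgue_not_in_finite[OF Z]
    by eventually_elim (use pointwise in \<open>auto simp: D_def algebra_simps\<close>)
  note C = set_integral_const[OF E(1,2), of D]
  have Iu: "set_integrable lebesgue E (\<lambda>t. \<Sum>k<N. u k t)"
    by (intro absolutely_integrable_sum U) auto
  have "\<sigma> * D \<le> (LINT t:E|lebesgue. ln (norm (p t)) + (\<Sum>k<N. u k t))"
    using set_integral_mono_AE[OF C(1) set_integral_add(1)[OF Ip(1) Iu] AE] C(2) by (simp add: \<sigma>_def)
  also have "\<dots> = (LINT t:E|lebesgue. ln (norm (p t))) + (LINT t:E|lebesgue. \<Sum>k<N. u k t)"
    by (rule set_integral_add(2)[OF Ip(1) Iu])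
  also have "(LINT t:E|lebesgue. \<Sum>k<N. u k t) = (\<Sum>k<N. LINT t:E|lebesgue. u k t)"
    using U(1) unfolding set_lebesgue_integral_def set_integrable_def scaleR_sum_right
    by (intro Bochner_Integration.integral_sum) auto
  also have "\<dots> \<le> (\<Sum>k<N. 8 * \<sigma>)" by (intro sum_mono U)
  also have "\<dots> = 8 * real N * \<sigma>" by simp
  also have "\<dots> \<le> 864 * n * \<sigma>" using N' \<sigma>0 by (intro mult_right_mono) auto
  finally have "D \<le> (LINT t:E|lebesgue. ln (norm (p t))) / \<sigma> + 864 * n"
    using \<sigma>0 by (simp add: field_simps)
  then show ?thesis unfolding D_def p_def \<sigma>_def l_def n_def by (simp add: algebra_simps)
qed

section \<open>Induction on the number of exponents\<close>

lemma single_exponential: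
  fixes a b :: real
  assumes nz: "expsum {\<alpha>} c z0 \<noteq> 0"
    and E: "E \<subseteq> {a..b}" "E \<in> sets lebesgue" "measure lebesgue E > 0" and y: "y \<in> {a..b}"
  shows "ln (norm (expsum {\<alpha>} c (of_real y))) \<le> (b - a) * \<bar>Re \<alpha>\<bar> +
    (LINT t:E|lebesgue. ln (norm (expsum {\<alpha>} c (of_real t)))) / measure lebesgue E"
proof -
  define D where "D = ln (norm (expsum {\<alpha>} c (of_real y))) - (b - a) * \<bar>Re \<alpha>\<bar>"
  have c: "c \<alpha> \<noteq> 0" using nz by (auto simp: expsum_def)
  have ln_eq: "ln (norm (expsum {\<alpha>} c (of_real t))) = ln (norm (c \<alpha>)) + Re \<alpha> * t" for t
    using c by (simp add: expsum_def norm_mult norm_exp_eq_Re ln_mult)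
  have "D \<le> ln (norm (expsum {\<alpha>} c (of_real t)))" if "t \<in> E" for t
  proof -
    have "t \<in> {a..b}" using E that by blast
    have "Re \<alpha> * (y - t) \<le> \<bar>Re \<alpha>\<bar> * \<bar>y - t\<bar>" by (metis abs_ge_self abs_mult)
    also have "\<dots> \<le> \<bar>Re \<alpha>\<bar> * (b - a)"
      using y \<open>t \<in> {a..b}\<close> by (intro mult_left_mono) auto
    finally show ?thesis unfolding D_def ln_eq by (simp add: algebra_simps)
  qed
  then have "(LINT t:E|lebesgue. D) \<le> (LINT t:E|lebesgue. ln (norm (expsum {\<alpha>} c (of_real t))))"
    using ln_norm_expsum_integrable(1)[OF _ _ nz E(1,2)]
    by (intro set_integral_mono set_integral_const[OF E(1,2)]) auto
  then show ?thesis
    using E(3) unfolding D_def set_integral_const[OF E(1,2)] by (simp add: field_simps)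
qed

text \<open>The term \<open>28 * exp 4\<close> comes from Harnack's inequality in
  \<open>small_diameter\<close>; 2000 leaves ample room over the 975 there and over the factor
  \<open>256 * exp 36\<close> of the induction step.\<close>

definition turan_nazarov_constant :: real where
  "turan_nazarov_constant = exp (2000 + 28 * exp 4)"

text \<open>An arbitrary bound \<open>M\<close> replaces the maximum of the real parts, because it
  is inherited by the smaller exponent sets of the induction.\<close>

theorem turan_nazarov_expsum:
  fixes a b M :: real
  assumes S: "finite S" "\<And>\<alpha>. \<alpha> \<in> S \<Longrightarrow> \<bar>Re \<alpha>\<bar> \<le> M" and nz: "expsum S c z0 \<noteq> 0"
    and E: "E \<subseteq> {a..b}" "E \<in> sets lebesgue" "measure lebesgue E > 0" and y: "y \<in> {a..b}"
  shows "norm (expsum S c (of_real y)) \<le> exp ((b - a) * M) *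
    (turan_nazarov_constant * (b - a) / measure lebesgue E) ^ (card S - 1) *
    exp ((LINT t:E|lebesgue. ln (norm (expsum S c (of_real t)))) / measure lebesgue E)"
  using S nz
proof (induction "card S" arbitrary: S c z0 rule: less_induct)
  case less
  define \<sigma> where "\<sigma> = measure lebesgue E"
  define l where "l = b - a"
  define C where "C = turan_nazarov_constant"
  define J where "J S c = (LINT t:E|lebesgue. ln (norm (expsum S c (of_real t)))) / \<sigma>" for S c
  have \<sigma>: "\<sigma> > 0" "\<sigma> \<le> l" and ab: "a < b" and l: "l > 0"
    using measure_subset_interval[OF E] E(3) by (auto simp: l_def \<sigma>_def)
  note [simp] = \<sigma>_def[symmetric] l_def[symmetric] C_def[symmetric]
  have C: "C > 0" unfolding C_def turan_nazarov_constant_def by simp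
  have ratio: "l / \<sigma> \<ge> 1" "C * l / \<sigma> > 0" using \<sigma> l C by auto
  have Sne: "S \<noteq> {}" using less.prems(3) by (auto simp: expsum_def)
  have card0: "card S > 0" using Sne less.prems(1) by (simp add: card_gt_0_iff)
  \<comment> \<open>A zero at \<open>y\<close> is set aside since \<open>ln 0\<close> is a default
    value; elsewhere it suffices to compare logarithms.\<close>
  have conclude: ?case
    if "expsum S c (of_real y) \<noteq> 0 \<Longrightarrow> ln (norm (expsum S c (of_real y))) \<le>
      l * M + real (card S - 1) * ln (C * l / \<sigma>) + J S c"
  proof (cases "expsum S c (of_real y) = 0")
    case True
    then show ?thesis using ratio by (auto intro!: mult_nonneg_nonneg)
  next
    case False
    then have "norm (expsum S c (of_real y)) = exp (ln (norm (expsum S c (of_real y))))" by simp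
    also have "\<dots> \<le> exp (l * M + real (card S - 1) * ln (C * l / \<sigma>) + J S c)"
      using that[OF False] by simp
    also have "\<dots> = exp (l * M) * (C * l / \<sigma>) ^ (card S - 1) * exp (J S c)"
      using ratio(2) by (simp only: exp_add exp_of_nat_mult exp_ln)
    finally show ?thesis by (simp add: J_def)
  qed
  have lM: "l * \<bar>Re \<alpha>\<bar> \<le> l * M" if "\<alpha> \<in> S" for \<alpha>
    using less.prems(2)[OF that] l by (intro mult_left_mono) auto
  have lnC: "ln (C * l / \<sigma>) = 2000 + 28 * exp 4 + ln (l / \<sigma>)"
    using l \<sigma> unfolding C_def turan_nazarov_constant_def by (simp add: ln_mult ln_div)
  show ?case
  proof (cases "card S = 1")
    case True
    then obtain \<alpha> where S: "S = {\<alpha>}" by (auto simp: card_1_singleton_iff)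
    show ?thesis
      using single_exponential[of \<alpha> c z0, OF _ E y] less.prems(3) lM[of \<alpha>]
      by (intro conclude) (auto simp: S J_def)
  next
    case False
    then have card2: "card S \<ge> 2" using card0 by linarith
    define n where "n = real (card S - 1)"
    have n: "n \<ge> 1" using card2 by (simp add: n_def)
    \<comment> \<open>The diameter, attained at some \<alpha> and \<beta>: the identity for
      \<open>(\<alpha> - \<beta>) p\<close> will be divided by exactly this \<open>d\<close>, which
      is also the radius of a disc about each exponent that contains \<open>S\<close>.\<close>
    define d where "d = Max ((\<lambda>(\<alpha>, \<beta>). dist \<alpha> \<beta>) ` (S \<times> S))"
    have "d \<in> (\<lambda>(\<alpha>, \<beta>). dist \<alpha> \<beta>) ` (S \<times> S)"
      unfolding d_def using less.prems(1) Sne by (intro Max_in) auto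
    then obtain \<alpha> \<beta> where ab': "\<alpha> \<in> S" "\<beta> \<in> S" "d = dist \<alpha> \<beta>" by auto
    have dmax: "dist x x' \<le> d" if "x \<in> S" "x' \<in> S" for x x'
      unfolding d_def using less.prems(1) that by (intro Max_ge) auto
    have sub: "S \<subseteq> cball x d" if "x \<in> S" for x using dmax[OF that] by auto
    have d0: "d \<ge> 0" using ab' by simp
    show ?thesis
    proof (cases "d * l \<le> n")
      case True
      show ?thesis
      proof (rule conclude)
        assume py: "expsum S c (of_real y) \<noteq> 0"
        have "ln (norm (expsum S c (of_real y))) \<le> l * \<bar>Re \<alpha>\<bar> + n * (ln (l / \<sigma>) + (975 + 28 * exp 4)) + J S c"
          using small_diameter[OF less.prems(1) card2 sub[OF ab'(1)] _ d0 less.prems(3) E y py] True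
          by (simp add: n_def J_def)
        also have "\<dots> \<le> l * M + n * ln (C * l / \<sigma>) + J S c"
        proof -
          have "n * (ln (l / \<sigma>) + (975 + 28 * exp 4)) \<le> n * ln (C * l / \<sigma>)"
            using n by (intro mult_left_mono) (auto simp: lnC)
          then show ?thesis using lM[OF ab'(1)] by linarith
        qed
        finally show "ln (norm (expsum S c (of_real y))) \<le>
          l * M + real (card S - 1) * ln (C * l / \<sigma>) + J S c" by (simp add: n_def)
      qed
    next
      case False
      then have dl: "n \<le> d * l" "d * l > 0" using n by auto
      have d: "d > 0" using dl(2) l by (simp add: zero_less_mult_iff)
      \<comment> \<open>The induction hypothesis supplies the power \<open>card S - 2\<close>, and
        \<open>elimination_step\<close> one more factor \<open>l / \<sigma>\<close> together with
        the \<open>d\<close> that cancels at the end; 36 = 4 + 32.\<close>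
      define R where "R = exp (l * M) * (C * l / \<sigma>) ^ (card S - 2) * (d * (128 * exp 36 * l / \<sigma>)) * exp (J S c)"
      have R0: "R \<ge> 0" unfolding R_def using ratio C l \<sigma> d by (auto intro!: mult_nonneg_nonneg)
      have step: "norm (expsum (S - {x}) (\<lambda>\<beta>. (\<beta> - x) * c \<beta>) (of_real y)) \<le> R" if x: "x \<in> S" for x
      proof (cases "\<exists>z1. expsum (S - {x}) (\<lambda>\<beta>. (\<beta> - x) * c \<beta>) z1 \<noteq> 0")
        \<comment> \<open>Coefficients in \<open>c\<close> may be 0, so the eliminated sum can
          vanish identically; the induction hypothesis does not apply then, but the bound is
          trivial.\<close>
        case False
        then show ?thesis using R0 by simp
      next
        case True
        then obtain z1 where z1: "expsum (S - {x}) (\<lambda>\<beta>. (\<beta> - x) * c \<beta>) z1 \<noteq> 0" by blast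
        have cardx: "card (S - {x}) = card S - 1" using x less.prems(1) by simp
        have "norm (expsum (S - {x}) (\<lambda>\<beta>. (\<beta> - x) * c \<beta>) (of_real y)) \<le> exp (l * M) *
            (C * l / \<sigma>) ^ (card S - 2) * exp (J (S - {x}) (\<lambda>\<beta>. (\<beta> - x) * c \<beta>))"
          using less.hyps[of "S - {x}" "\<lambda>\<beta>. (\<beta> - x) * c \<beta>" z1] z1 less.prems card0
          unfolding cardx by (simp add: J_def numeral_2_eq_2)
        also have "J (S - {x}) (\<lambda>\<beta>. (\<beta> - x) * c \<beta>) \<le> ln (d * (128 * exp 36 * l / \<sigma>)) + J S c"
        proof -
          have "(LINT t:E|lebesgue. ln (norm (expsum (S - {x}) (\<lambda>\<beta>. (\<beta> - x) * c \<beta>) (of_real t)))) \<le>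
              \<sigma> * (ln (128 * exp 4 * d * l / \<sigma>) + 32) + (LINT t:E|lebesgue. ln (norm (expsum S c (of_real t))))"
            using elimination_step[OF less.prems(1) card2 sub[OF x] _ less.prems(3) z1 E] dl(1)
            by (simp add: n_def)
          then have "J (S - {x}) (\<lambda>\<beta>. (\<beta> - x) * c \<beta>) \<le> ln (128 * exp 4 * d * l / \<sigma>) + 32 + J S c"
            using \<sigma> unfolding J_def by (simp add: field_simps)
          also have "ln (128 * exp 4 * d * l / \<sigma>) + 32 = ln (128 * exp 4 * d * l / \<sigma> * exp 32)"
            using d l \<sigma> by (subst ln_mult_pos) auto
          also have "128 * exp 4 * d * l / \<sigma> * exp 32 = d * (128 * (exp 4 * exp 32) * l / \<sigma>)"
            by simp
          also have "exp 4 * exp 32 = (exp 36 :: real)" by (simp add: exp_add[symmetric])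
          finally show ?thesis .
        qed
        also have "exp (ln (d * (128 * exp 36 * l / \<sigma>)) + J S c) = d * (128 * exp 36 * l / \<sigma>) * exp (J S c)"
          unfolding exp_add using d l \<sigma> by (subst exp_ln) auto
        finally show ?thesis using ratio unfolding R_def by (simp add: mult_left_mono mult.assoc)
      qed
      have "d * norm (expsum S c (of_real y)) = norm ((\<alpha> - \<beta>) * expsum S c (of_real y))"
        using ab'(3) by (simp add: norm_mult dist_norm)
      also have "(\<alpha> - \<beta>) * expsum S c (of_real y) =
          expsum (S - {\<beta>}) (\<lambda>x. (x - \<beta>) * c x) (of_real y) - expsum (S - {\<alpha>}) (\<lambda>x. (x - \<alpha>) * c x) (of_real y)"
        unfolding expsum_diff_deriv[OF less.prems(1), symmetric] by (simp add: algebra_simps)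
      also have "norm \<dots> \<le> R + R"
        using norm_triangle_ineq4 step[OF ab'(1)] step[OF ab'(2)] by (meson add_mono order_trans)
      also have "\<dots> = d * (exp (l * M) * (C * l / \<sigma>) ^ (card S - 2) * (256 * exp 36 * l / \<sigma>) * exp (J S c))"
        by (simp add: R_def)
      finally have "norm (expsum S c (of_real y)) \<le>
          exp (l * M) * (C * l / \<sigma>) ^ (card S - 2) * (256 * exp 36 * l / \<sigma>) * exp (J S c)"
        using d by (rule mult_left_le_imp_le)
      also have "\<dots> \<le> exp (l * M) * (C * l / \<sigma>) ^ (card S - 2) * (C * l / \<sigma>) * exp (J S c)"
      proof (intro mult_right_mono mult_left_mono divide_right_mono)
        have "(256::real) * exp 36 \<le> exp 1000 * exp 36"
          using exp_ge_add_one_self[of 1000] by (intro mult_right_mono) auto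
        also have "\<dots> \<le> C"
          unfolding C_def turan_nazarov_constant_def exp_add[symmetric] by simp
        finally show "256 * exp 36 \<le> C" .
      qed (use l \<sigma> ratio in auto)
      also have "\<dots> = exp (l * M) * (C * l / \<sigma>) ^ (card S - 1) * exp (J S c)"
      proof -
        have "card S - 1 = Suc (card S - 2)" using card2 by simp
        then show ?thesis by (simp only: power_Suc2 mult.assoc)
      qed
      finally show ?thesis by (simp add: J_def)
    qed
  qed
qed

section \<open>From closed intervals to arbitrary bounded intervals\<close>

lemma bounded_interval_closure:
  fixes I :: "real set"
  assumes "is_interval I" "bounded I" "I \<noteq> {}"
  obtains a b where "I \<subseteq> {a..b}" "measure lebesgue I = b - a"
proof -
  have *: "closed (closure I)" "is_interval (closure I)" "bounded (closure I)" "closure I \<noteq> {}"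
    using assms by (auto simp: is_interval_convex_1 convex_closure)
  then have "compact (closure I)" by (simp add: compact_eq_bounded_closed)
  then obtain a b where ab: "closure I = {a..b}"
    using *(2) is_interval_compact by (metis interval_cbox is_interval_compact box_real(2))
  then have "a \<le> b" using *(4) by auto
  \<comment> \<open>A convex set has a negligible frontier, so taking the closure does not change
    the measure.\<close>
  have "convex I" using assms(1) by (simp add: is_interval_convex_1)
  then have "measure lebesgue (closure I) = measure lebesgue I"
    using assms(2) by (intro measure_closure negligible_convex_frontier)
  then have "measure lebesgue I = b - a" using ab \<open>a \<le> b\<close> by simp
  moreover have "I \<subseteq> {a..b}" using ab closure_subset by blast
  ultimately show ?thesis by (rule that[rotated])
qed

theorem theorem1p2:
  "\<exists>C::real. C > 0 \<and>
     (\<forall>(m::nat) (c::nat \<Rightarrow> complex) (\<alpha>::nat \<Rightarrow> complex) (p::real \<Rightarrow> complex) (I::real set) (E::real set).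
        m \<ge> 1 \<longrightarrow>
        (\<forall>t. p t = (\<Sum>j=1..m. c j * exp (\<alpha> j * complex_of_real t))) \<longrightarrow>
        (\<exists>t. p t \<noteq> 0) \<longrightarrow>
        exp_ord p \<le> m \<longrightarrow>
        is_interval I \<longrightarrow> bounded I \<longrightarrow>
        E \<subseteq> I \<longrightarrow> E \<in> sets lebesgue \<longrightarrow> measure lebesgue E > 0 \<longrightarrow>
        (SUP t\<in>I. norm (p t))
          \<le> exp (measure lebesgue I * (MAX \<mu>\<in>exp_spec p. \<bar>Re \<mu>\<bar>))
             * (C * measure lebesgue I / measure lebesgue E) ^ (m - 1)
             * geo_mean E p)"
proof (intro exI[of _ turan_nazarov_constant] conjI allI impI)
  show "turan_nazarov_constant > 0" by (simp add: turan_nazarov_constant_def)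
next
  fix m :: nat and c \<alpha> :: "nat \<Rightarrow> complex" and p :: "real \<Rightarrow> complex" and I E :: "real set"
  assume p: "\<forall>t. p t = (\<Sum>j=1..m. c j * exp (\<alpha> j * complex_of_real t))" and nz: "\<exists>t. p t \<noteq> 0"
    and ord: "exp_ord p \<le> m" and I: "is_interval I" "bounded I"
    and E: "E \<subseteq> I" "E \<in> sets lebesgue" "measure lebesgue E > 0"
  obtain S d where red: "reduced_form p S d" using ex_reduced_form p by blast
  have spec: "exp_spec p = S" using exp_spec_eq[OF red] .
  have S: "finite S" and pS: "p = (\<lambda>t. expsum S d (of_real t))"
    using red by (auto simp: reduced_form_def expsum_def)
  obtain t0 where t0: "p t0 \<noteq> 0" using nz by blast
  have "E \<noteq> {}" using E(3) by auto
  then have "I \<noteq> {}" using E(1) by blast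
  obtain a b where ab: "I \<subseteq> {a..b}" "measure lebesgue I = b - a"
    using bounded_interval_closure[OF I \<open>I \<noteq> {}\<close>] .
  have Eab: "E \<subseteq> {a..b}" using E(1) ab(1) by blast
  note bounds = measure_subset_interval[OF Eab E(2,3)]
  define M where "M = (MAX \<mu>\<in>S. \<bar>Re \<mu>\<bar>)"
  have M: "\<bar>Re \<mu>\<bar> \<le> M" if "\<mu> \<in> S" for \<mu> unfolding M_def using S that by (intro Max_ge) auto
  \<comment> \<open>The base of the power must be at least 1 in order to raise the exponent from
    \<open>card S - 1\<close> to \<open>m - 1\<close>.\<close>
  have C: "turan_nazarov_constant \<ge> 1" by (simp add: turan_nazarov_constant_def add_nonneg_nonneg)
  have "measure lebesgue E \<le> turan_nazarov_constant * (b - a)"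
  proof -
    have "1 * (b - a) \<le> turan_nazarov_constant * (b - a)"
      using C bounds(1) by (intro mult_right_mono) auto
    then show ?thesis using bounds(2) by (metis mult_1 order_trans)
  qed
  then have base: "turan_nazarov_constant * (b - a) / measure lebesgue E \<ge> 1" using E(3) by simp
  show "(SUP t\<in>I. norm (p t)) \<le> exp (measure lebesgue I * (MAX \<mu>\<in>exp_spec p. \<bar>Re \<mu>\<bar>))
      * (turan_nazarov_constant * measure lebesgue I / measure lebesgue E) ^ (m - 1) * geo_mean E p"
    unfolding spec M_def[symmetric] ab(2)
  proof (rule cSUP_least[OF \<open>I \<noteq> {}\<close>])
    fix y assume "y \<in> I"
    then have y: "y \<in> {a..b}" using ab by blast
    have "norm (p y) \<le> exp ((b - a) * M) *
      (turan_nazarov_constant * (b - a) / measure lebesgue E) ^ (card S - 1) * geo_mean E p"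
      using turan_nazarov_expsum[OF S M _ Eab E(2,3) y, of d "of_real t0"] t0
      by (simp add: pS geo_mean_def)
    also have "\<dots> \<le> exp ((b - a) * M) *
      (turan_nazarov_constant * (b - a) / measure lebesgue E) ^ (m - 1) * geo_mean E p"
      using base ord unfolding exp_ord_def spec geo_mean_def
      by (intro mult_right_mono mult_left_mono power_increasing) auto
    finally show "norm (p y) \<le> exp ((b - a) * M) *
      (turan_nazarov_constant * (b - a) / measure lebesgue E) ^ (m - 1) * geo_mean E p" .
  qed
qed

end
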